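(* Assuming Gap-ETH, for no computable function $f$ and no polynomial $p$ is there an algorithm running in time $f(k)\cdot n^{o(k)}$ that, given an instance of FR-$k$-Med-O (or FR-$k$-Means-O) of size $n$, outputs a feasible solution of cost at most $p(n)$ times the optimum. This hardness holds even when the number of groups is $O(k^3\log n)$ and even when the metric is a tree metric.
   Context: Fair-range $k$-clustering: an instance consists of positive integers $k,t$, clients $C$, facilities $F$, a metric $d$ on $C\cup F$ (the shortest-path metric of a weighted graph $H$ whose vertex set contains $C\cup F$; $n$ is the number of vertices of $H$), groups $G_1,\dots,G_t\subseteq F$ (possibly intersecting), and integers $\alpha_i\le\beta_i$. A set $S\subseteq F$ with $|S|\le k$ is feasible if $\alpha_i\le |S\cap G_i|\le\beta_i$ for all $i$. FR-$k$-Med minimizes $\sum_{c\in C}d(c,S)$ and FR-$k$-Means minimizes $\sum_{c\in C}d(c,S)^2$ over feasible $S$. A tree metric means $H$ is a tree. FR-$k$-Med-O (FR-$k$-Means-O) is the restriction to instances for which a feasible solution can be found in polynomial time. Gap-ETH (randomized Gap Exponential Time Hypothesis): there exist constants $\epsilon,\tau>0$ such that no randomized algorithm, given a 3-SAT formula $\phi$ on $n'$ variables and $O(n')$ clauses, can distinguish with probability $2/3$ in time $O(2^{\tau n'})$ between the case that some assignment satisfies all clauses and the case that every assignment satisfies fewer than a $(1-\epsilon)$ fraction of the clauses. *)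

theory Defs
  imports
    "HOL-Probability.Probability_Mass_Function"
    "HOL-Computational_Algebra.Polynomial"
    "HOL-Library.Landau_Symbols"
    "Graph_Theory.Graph_Theory"
begin

section \<open>Model of computation\<close>

text \<open>
  The model is the language WHILE of N. D. Jones (Computability and Complexity from a Programming
  Perspective, 1997), extended by a fair coin toss. Data are binary trees; every elementary command
  costs one step. WHILE programs and multi-tape Turing machines simulate each other with polynomial
  overhead, trees being implemented by shared pointer structures. Time bounds of the forms
  \<open>2 ^ (\<tau> n)\<close> for some constant \<open>\<tau> > 0\<close>, \<open>f(k) n ^ o(k)\<close> and \<open>n ^ O(1)\<close>, the only
  ones used below, do not depend on the choice among polynomially equivalent models.
\<close>

datatype val = Leaf | Node val val

datatype exp = Var nat | LeafE | NodeE exp exp | Hd exp | Tl exp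

datatype com =
    Skip
  | Assign nat exp
  | Flip nat
  | Seq com com
  | If exp com com
  | While exp com

type_synonym store = "nat \<Rightarrow> val"

fun left :: "val \<Rightarrow> val" where
  "left Leaf = Leaf"
| "left (Node a b) = a"

fun right :: "val \<Rightarrow> val" where
  "right Leaf = Leaf"
| "right (Node a b) = b"

primrec eval :: "exp \<Rightarrow> store \<Rightarrow> val" where
  "eval (Var x) s = s x"
| "eval LeafE s = Leaf"
| "eval (NodeE e e') s = Node (eval e s) (eval e' s)"
| "eval (Hd e) s = left (eval e s)"
| "eval (Tl e) s = right (eval e s)"

definition enc_bool :: "bool \<Rightarrow> val" where
  "enc_bool b = (if b then Node Leaf Leaf else Leaf)"

text \<open>
  A configuration consists of the list of commands still to be executed and the store. The test
  of a conditional or a loop succeeds iff its value is not \<open>Leaf\<close>.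
\<close>

type_synonym config = "com list \<times> store"

fun step :: "config \<Rightarrow> config pmf" where
  "step ([], s) = return_pmf ([], s)"
| "step (Skip # cs, s) = return_pmf (cs, s)"
| "step (Assign x e # cs, s) = return_pmf (cs, s(x := eval e s))"
| "step (Flip x # cs, s) = map_pmf (\<lambda>b. (cs, s(x := enc_bool b))) (bernoulli_pmf (1/2))"
| "step (Seq c d # cs, s) = return_pmf (c # d # cs, s)"
| "step (If e c d # cs, s) = return_pmf ((if eval e s \<noteq> Leaf then c else d) # cs, s)"
| "step (While e c # cs, s) =
     return_pmf (if eval e s \<noteq> Leaf then c # While e c # cs else cs, s)"

primrec run :: "nat \<Rightarrow> config \<Rightarrow> config pmf" where
  "run 0 cfg = return_pmf cfg"
| "run (Suc t) cfg = bind_pmf (step cfg) (run t)"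

text \<open>Input and output are passed in variable 0; all other variables are initially \<open>Leaf\<close>.\<close>

definition start :: "com \<Rightarrow> val \<Rightarrow> config" where
  "start c x = ([c], (\<lambda>_. Leaf)(0 := x))"

text \<open>Since a halted configuration is never left, \<open>t\<close> is an upper bound on the running time.\<close>

definition halts_within :: "com \<Rightarrow> val \<Rightarrow> nat \<Rightarrow> bool" where
  "halts_within c x t \<longleftrightarrow> (\<forall>(cs, s) \<in> set_pmf (run t (start c x)). cs = [])"

definition prob_output :: "com \<Rightarrow> val \<Rightarrow> nat \<Rightarrow> val \<Rightarrow> real" where
  "prob_output c x t y =
     measure_pmf.prob (run t (start c x)) {(cs, s). cs = [] \<and> s 0 = y}"

primrec deterministic :: "com \<Rightarrow> bool" where
  "deterministic Skip = True"
| "deterministic (Assign x e) = True"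
| "deterministic (Flip x) = False"
| "deterministic (Seq c d) = (deterministic c \<and> deterministic d)"
| "deterministic (If e c d) = (deterministic c \<and> deterministic d)"
| "deterministic (While e c) = deterministic c"

definition computes_within :: "com \<Rightarrow> val \<Rightarrow> nat \<Rightarrow> val \<Rightarrow> bool" where
  "computes_within c x t y \<longleftrightarrow>
     deterministic c \<and> (\<exists>s. run t (start c x) = return_pmf ([], s) \<and> s 0 = y)"

section \<open>Encodings\<close>

text \<open>Numbers are encoded in binary, least significant bit first and without leading zeros.\<close>

fun enc_nat :: "nat \<Rightarrow> val" where
  "enc_nat n = (if n = 0 then Leaf else Node (enc_bool (odd n)) (enc_nat (n div 2)))"

declare enc_nat.simps [simp del]

definition enc_int :: "int \<Rightarrow> val" where
  "enc_int i = Node (enc_bool (i < 0)) (enc_nat (nat \<bar>i\<bar>))"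

definition enc_prod :: "('a \<Rightarrow> val) \<Rightarrow> ('b \<Rightarrow> val) \<Rightarrow> 'a \<times> 'b \<Rightarrow> val" where
  "enc_prod f g p = Node (f (fst p)) (g (snd p))"

definition enc_rat :: "rat \<Rightarrow> val" where
  "enc_rat q = enc_prod enc_int enc_int (quotient_of q)"

definition enc_list :: "('a \<Rightarrow> val) \<Rightarrow> 'a list \<Rightarrow> val" where
  "enc_list f xs = foldr (\<lambda>x v. Node (f x) v) xs Leaf"

definition computable :: "(nat \<Rightarrow> nat) \<Rightarrow> bool" where
  "computable f \<longleftrightarrow> (\<exists>c. \<forall>k. \<exists>t. computes_within c (enc_nat k) t (enc_nat (f k)))"

section \<open>The randomized Gap Exponential Time Hypothesis\<close>

text \<open>A literal is a variable together with its sign; \<open>True\<close> marks a positive literal.\<close>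

type_synonym literal = "nat \<times> bool"
type_synonym cnf = "literal list list"

definition is_3cnf :: "nat \<Rightarrow> cnf \<Rightarrow> bool" where
  "is_3cnf N \<phi> \<longleftrightarrow> (\<forall>C \<in> set \<phi>. length C \<le> 3 \<and> (\<forall>(x, b) \<in> set C. x < N))"

definition sat_clause :: "(nat \<Rightarrow> bool) \<Rightarrow> literal list \<Rightarrow> bool" where
  "sat_clause a C \<longleftrightarrow> (\<exists>(x, b) \<in> set C. a x = b)"

definition num_sat :: "(nat \<Rightarrow> bool) \<Rightarrow> cnf \<Rightarrow> nat" where
  "num_sat a \<phi> = length (filter (sat_clause a) \<phi>)"

definition enc_cnf :: "nat \<times> cnf \<Rightarrow> val" where
  "enc_cnf = enc_prod enc_nat (enc_list (enc_list (enc_prod enc_nat enc_bool)))"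

text \<open>\<open>\<Delta>\<close> is the constant in the linear bound on the number of clauses.\<close>

definition distinguishes_gap_3sat :: "real \<Rightarrow> real \<Rightarrow> real \<Rightarrow> com \<Rightarrow> bool" where
  "distinguishes_gap_3sat \<epsilon> \<tau> \<Delta> c \<longleftrightarrow>
     (\<exists>B. \<forall>N \<phi>. is_3cnf N \<phi> \<and> real (length \<phi>) \<le> \<Delta> * real N \<longrightarrow>
       (\<exists>t. real t \<le> B * 2 powr (\<tau> * real N) \<and>
         halts_within c (enc_cnf (N, \<phi>)) t \<and>
         ((\<exists>a. num_sat a \<phi> = length \<phi>) \<longrightarrow>
            prob_output c (enc_cnf (N, \<phi>)) t (enc_bool True) \<ge> 2/3) \<and>
         ((\<forall>a. real (num_sat a \<phi>) < (1 - \<epsilon>) * real (length \<phi>)) \<longrightarrow>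
            prob_output c (enc_cnf (N, \<phi>)) t (enc_bool False) \<ge> 2/3)))"

definition gap_eth :: bool where
  "gap_eth \<longleftrightarrow> (\<exists>\<epsilon> > 0. \<exists>\<tau> > 0. \<exists>\<Delta> > 0. \<not> (\<exists>c. distinguishes_gap_3sat \<epsilon> \<tau> \<Delta> c))"

section \<open>Fair-range clustering\<close>

text \<open>
  The vertices of \<open>H\<close> are \<open>0, \<dots>, num_verts - 1\<close>. Every undirected edge is listed once, as
  \<open>((u, v), w)\<close> with \<open>u < v\<close>. A group is listed with its bounds \<open>\<alpha>\<close> and \<open>\<beta>\<close>.
\<close>

record fr_instance =
  budget :: nat
  num_verts :: nat
  edges :: "((nat \<times> nat) \<times> rat) list"
  clients :: "nat list"
  facilities :: "nat list"
  groups :: "(nat list \<times> int \<times> int) list"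

definition graph_of :: "fr_instance \<Rightarrow> (nat, nat \<times> nat) pre_digraph" where
  "graph_of I = with_proj
     \<lparr>pverts = {..<num_verts I},
      parcs = fst ` set (edges I) \<union> prod.swap ` fst ` set (edges I)\<rparr>"

definition weight :: "fr_instance \<Rightarrow> nat \<times> nat \<Rightarrow> real" where
  "weight I = (\<lambda>(u, v). real_of_rat (the (map_of (edges I) (min u v, max u v))))"

definition sp_dist :: "fr_instance \<Rightarrow> nat \<Rightarrow> nat \<Rightarrow> ereal" where
  "sp_dist I u v = wf_digraph.\<mu> (graph_of I) (weight I) u v"

text \<open>
  Positivity of the weights makes the shortest-path distance a metric and not only a pseudometric.
\<close>

definition is_fr_instance :: "fr_instance \<Rightarrow> bool" where
  "is_fr_instance I \<longleftrightarrow>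
     budget I > 0 \<and>
     (\<forall>((u, v), w) \<in> set (edges I). u < v \<and> v < num_verts I \<and> w > 0) \<and>
     distinct (map fst (edges I)) \<and>
     Digraph_Component.connected (graph_of I) \<and>
     distinct (clients I) \<and> set (clients I) \<subseteq> {..<num_verts I} \<and>
     distinct (facilities I) \<and> set (facilities I) \<subseteq> {..<num_verts I} \<and>
     groups I \<noteq> [] \<and>
     (\<forall>(G, \<alpha>, \<beta>) \<in> set (groups I). distinct G \<and> set G \<subseteq> set (facilities I) \<and> \<alpha> \<le> \<beta>)"

text \<open>
  In a symmetric digraph, the library's \<^const>\<open>forest\<close> counts each edge, traversed back and forth,
  as a cycle. Cycles of the undirected graph are those of length at least 3.
\<close>

definition tree_metric :: "fr_instance \<Rightarrow> bool" where
  "tree_metric I \<longleftrightarrow>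
     Digraph_Component.connected (graph_of I) \<and>
     \<not> (\<exists>p. pre_digraph.cycle (graph_of I) p \<and> length p \<ge> 3)"

definition fr_feasible :: "fr_instance \<Rightarrow> nat set \<Rightarrow> bool" where
  "fr_feasible I S \<longleftrightarrow>
     S \<subseteq> set (facilities I) \<and> card S \<le> budget I \<and>
     (\<forall>(G, \<alpha>, \<beta>) \<in> set (groups I). \<alpha> \<le> int (card (S \<inter> set G)) \<and> int (card (S \<inter> set G)) \<le> \<beta>)"

text \<open>The distance to the empty set is \<open>\<infinity>\<close>.\<close>

definition set_dist :: "fr_instance \<Rightarrow> nat \<Rightarrow> nat set \<Rightarrow> ereal" where
  "set_dist I c S = (INF s \<in> S. sp_dist I c s)"

definition med_cost :: "fr_instance \<Rightarrow> nat set \<Rightarrow> ereal" where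
  "med_cost I S = (\<Sum>c \<in> set (clients I). set_dist I c S)"

definition means_cost :: "fr_instance \<Rightarrow> nat set \<Rightarrow> ereal" where
  "means_cost I S = (\<Sum>c \<in> set (clients I). (set_dist I c S)\<^sup>2)"

definition opt_cost :: "(fr_instance \<Rightarrow> nat set \<Rightarrow> ereal) \<Rightarrow> fr_instance \<Rightarrow> ereal" where
  "opt_cost cost I = (INF S \<in> {S. fr_feasible I S}. cost I S)"

definition enc_instance :: "fr_instance \<Rightarrow> val" where
  "enc_instance I =
     Node (enc_nat (budget I))
    (Node (enc_nat (num_verts I))
    (Node (enc_list (enc_prod (enc_prod enc_nat enc_nat) enc_rat) (edges I))
    (Node (enc_list enc_nat (clients I))
    (Node (enc_list enc_nat (facilities I))
          (enc_list (enc_prod (enc_list enc_nat) (enc_prod enc_int enc_int)) (groups I))))))"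

definition outputs_feasible :: "com \<Rightarrow> fr_instance \<Rightarrow> nat \<Rightarrow> nat set \<Rightarrow> bool" where
  "outputs_feasible c I t S \<longleftrightarrow>
     (\<exists>xs. distinct xs \<and> set xs = S \<and>
        computes_within c (enc_instance I) t (enc_list enc_nat xs)) \<and>
     fr_feasible I S"

text \<open>
  "A feasible solution can be found in polynomial time" is a property of a family of instances: one
  polynomial-time algorithm has to serve all of its members. The number \<open>n\<close> of vertices is the size
  of an instance, so the length of the encoding (in particular of the weights) is required to be
  polynomial in \<open>n\<close>; otherwise no algorithm with a running time bounded in terms of \<open>k\<close> and
  \<open>n\<close> could read its input.
\<close>

definition fr_o_family :: "fr_instance set \<Rightarrow> bool" where
  "fr_o_family \<I> \<longleftrightarrow>
     (\<forall>I \<in> \<I>. is_fr_instance I) \<and>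
     (\<exists>q :: real poly. \<forall>I \<in> \<I>. real (size (enc_instance I)) \<le> poly q (real (num_verts I))) \<and>
     (\<exists>c. \<exists>q :: real poly. \<forall>I \<in> \<I>. \<exists>t S.
        real t \<le> poly q (real (size (enc_instance I))) \<and> outputs_feasible c I t S)"

definition approximates_within ::
  "com \<Rightarrow> (fr_instance \<Rightarrow> nat set \<Rightarrow> ereal) \<Rightarrow> fr_instance set
     \<Rightarrow> (fr_instance \<Rightarrow> real) \<Rightarrow> (fr_instance \<Rightarrow> real) \<Rightarrow> bool" where
  "approximates_within c cost \<I> T \<rho> \<longleftrightarrow>
     (\<forall>I \<in> \<I>. \<exists>t S. real t \<le> T I \<and> outputs_feasible c I t S \<and>
        cost I S \<le> ereal (\<rho> I) * opt_cost cost I)"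

end

theory Submission
  imports Defs "HOL-Real_Asymp.Real_Asymp"
begin

text \<open>
  Let \<open>k = 2 ^ K\<close>. The variables of a formula are split into \<open>k\<close> blocks of about \<open>N / k\<close>
  variables, and the facilities are the \<open>2 ^ O(N / k)\<close> assignments of each block together with one
  extra facility \<open>1\<close>. All facilities are leaves of a star whose centre is the only client; the
  extra facility is exponentially farther away than the others. A group for each block admits at most
  one of its assignments, a group for each clause requires one of the assignments that satisfy it, and
  the extra facility belongs to all groups. Thus \<open>{1}\<close> is always feasible, but the feasible
  solutions of small cost are the satisfying assignments, so that an approximation within a polynomial
  factor decides satisfiability. As \<open>k\<close> may be any constant, a running time of \<open>f(k) n ^ o(k)\<close>
  becomes \<open>O(2 ^ (\<tau> N))\<close> for every \<open>\<tau> > 0\<close>. The gap of the formula is not used: the hardness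
  comes from the freedom to choose edge weights with polynomially many bits.
\<close>

text \<open>Two quantities constrain \<open>K\<close>: the exponent of the reduction's own running
  time and the o(k) of the hypothetical algorithm. To avoid circularity the first must be known
  before \<open>K\<close> is chosen. So the reduction is one program that receives \<open>K\<close>
  in unary together with the formula, and its time is polynomial in a measure that is O(2 ^ (2 N /
  k)) for fixed \<open>K\<close>. This program has to be exhibited in WHILE; it is assembled from a
  calculus of polynomial-time functions, closed under composition, pairing, case distinction and
  list iteration. With k a power of two, the block of a variable is given by its low bits and its
  position by its high bits, so arithmetic becomes walking along bit lists, and lists of the right
  length serve as counters. Rounding to powers of two gives up to about 2 N / k variables per block,
  a constant factor absorbed by the exponents. The far weight is 2 ^ (n - 1) for n vertices: it
  eventually exceeds every polynomial in n, yet has only n bits, so encodings stay polynomial in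
  n.\<close>

definition executes :: "com \<Rightarrow> store \<Rightarrow> nat \<Rightarrow> store \<Rightarrow> bool" where
  "executes c s t s' \<longleftrightarrow> (\<forall>cs. run t (c # cs, s) = return_pmf (cs, s'))"

lemma run_add: "run (a + b) cfg = bind_pmf (run a cfg) (run b)"
  by (induction a arbitrary: cfg) (simp_all add: bind_return_pmf bind_assoc_pmf fun_eq_iff cong: bind_pmf_cong)

lemma executes_Assign: "executes (Assign x e) s 1 (s(x := eval e s))"
  by (simp add: executes_def bind_return_pmf)

lemma executes_Skip: "executes Skip s 1 s"
  by (simp add: executes_def bind_return_pmf)

text \<open>Quantifying over the continuation in \<open>executes\<close> makes composition an
  addition of times: \<open>c\<close> runs in front of \<open>d # cs\<close>, then \<open>d\<close>
  in front of \<open>cs\<close>. The extra step unfolds \<open>Seq\<close>.\<close>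

lemma executes_Seq:
  assumes "executes c s t1 s1" "executes d s1 t2 s2"
  shows "executes (Seq c d) s (Suc (t1 + t2)) s2"
  using assms by (simp add: executes_def bind_return_pmf run_add)

lemma executes_If:
  assumes "executes (if eval e s \<noteq> Leaf then c else d) s t s'"
  shows "executes (If e c d) s (Suc t) s'"
  using assms by (simp add: executes_def bind_return_pmf)

lemma executes_While_False: "eval e s = Leaf \<Longrightarrow> executes (While e c) s 1 s"
  by (simp add: executes_def bind_return_pmf)

lemma executes_While_True:
  assumes "eval e s \<noteq> Leaf" "executes c s t1 s1" "executes (While e c) s1 t2 s2"
  shows "executes (While e c) s (Suc (t1 + t2)) s2"
  using assms by (simp add: executes_def bind_return_pmf run_add)

section \<open>Deterministic runs in front of a continuation\<close>

lemma run_Nil: "run t ([], s) = return_pmf ([], s)"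
  by (induction t) (simp_all add: bind_return_pmf)

text \<open>Determinism turns a run that empties its own command list into a run that leaves an appended
  continuation untouched.\<close>

lemma step_deterministic:
  assumes "\<forall>c \<in> set cs. deterministic c" "cs \<noteq> []"
  shows "\<exists>cs' s'. (\<forall>c \<in> set cs'. deterministic c) \<and>
    (\<forall>ds. step (cs @ ds, s) = return_pmf (cs' @ ds, s'))"
proof (cases cs)
  case Nil
  with assms show ?thesis by simp
next
  case (Cons c cs0)
  with assms have det: "\<forall>d \<in> set cs0. deterministic d" "deterministic c" by auto
  show ?thesis
  proof (cases c)
    case Skip
    with Cons det show ?thesis by (intro exI[of _ cs0] exI[of _ s]) simp
  next
    case (Assign x e)
    with Cons det show ?thesis
      by (intro exI[of _ cs0] exI[of _ "s(x := eval e s)"]) simp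
  next
    case (Flip x)
    with det show ?thesis by simp
  next
    case (Seq c1 c2)
    with Cons det show ?thesis
      by (intro exI[of _ "c1 # c2 # cs0"] exI[of _ s]) simp
  next
    case (If e c1 c2)
    with Cons det show ?thesis
      by (intro exI[of _ "(if eval e s \<noteq> Leaf then c1 else c2) # cs0"] exI[of _ s]) simp
  next
    case (While e c1)
    with Cons det show ?thesis
      by (intro exI[of _ "if eval e s \<noteq> Leaf then c1 # While e c1 # cs0 else cs0"] exI[of _ s])
        simp
  qed
qed

text \<open>Only \<open>t' \<le> t\<close> can be promised: a halted configuration idles, so
  \<open>t\<close> may exceed the moment of halting, and with \<open>ds\<close> appended the idle
  steps would start executing \<open>ds\<close>.\<close>

lemma run_frame:
  assumes "\<forall>c \<in> set cs. deterministic c" "run t (cs, s) = return_pmf ([], s')"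
  shows "\<exists>t' \<le> t. \<forall>ds. run t' (cs @ ds, s) = return_pmf (ds, s')"
  using assms
proof (induction t arbitrary: cs s)
  case 0
  then show ?case by (intro exI[of _ 0]) simp
next
  case (Suc t)
  show ?case
  proof (cases "cs = []")
    case True
    with Suc.prems(2) have "s' = s" by (simp only: run_Nil) simp
    with True show ?thesis by (intro exI[of _ 0]) simp
  next
    case False
    from step_deterministic[OF Suc.prems(1) False, of s] obtain cs1 s1 where
      det: "\<forall>c \<in> set cs1. deterministic c" and
      step: "\<And>ds. step (cs @ ds, s) = return_pmf (cs1 @ ds, s1)" by blast
    have "run t (cs1, s1) = return_pmf ([], s')"
      using Suc.prems(2) step[of "[]"] by (simp add: bind_return_pmf)
    from Suc.IH[OF det this] obtain t' where
      "t' \<le> t" "\<forall>ds. run t' (cs1 @ ds, s1) = return_pmf (ds, s')" by blast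
    then show ?thesis
      by (intro exI[of _ "Suc t'"]) (simp add: step bind_return_pmf)
  qed
qed

text \<open>The hypothetical approximation algorithm is known only through
  \<open>computes_within\<close>. This makes it usable as a subprogram, though only from a store in
  which all variables except 0 are \<open>Leaf\<close>.\<close>

lemma computes_within_executes:
  assumes "computes_within c x t y"
  shows "\<exists>t' \<le> t. \<exists>s'. executes c ((\<lambda>_. Leaf)(0 := x)) t' s' \<and> s' 0 = y"
proof -
  from assms obtain s' where det: "deterministic c" and s': "s' 0 = y"
    and r: "run t ([c], (\<lambda>_. Leaf)(0 := x)) = return_pmf ([], s')"
    by (auto simp: computes_within_def start_def)
  from run_frame[OF _ r] det obtain t' where "t' \<le> t"
    "\<forall>ds. run t' ([c] @ ds, (\<lambda>_. Leaf)(0 := x)) = return_pmf (ds, s')"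
    by auto
  with s' show ?thesis by (auto simp: executes_def)
qed

section \<open>Polynomial bounds\<close>

text \<open>The bound holds at every point and not just eventually, so it can be used inside loops
  and compositions; \<open>Suc\<close> keeps it meaningful where the measure vanishes.\<close>

definition poly_bounded :: "('a \<Rightarrow> nat) \<Rightarrow> ('a \<Rightarrow> nat) \<Rightarrow> bool" where
  "poly_bounded \<mu> h \<longleftrightarrow> (\<exists>C d. \<forall>x. h x \<le> C * Suc (\<mu> x) ^ d)"

lemma poly_bounded_mono: "poly_bounded \<mu> h \<Longrightarrow> (\<And>x. h' x \<le> h x) \<Longrightarrow> poly_bounded \<mu> h'"
  unfolding poly_bounded_def by (meson order_trans)

lemma poly_bounded_const [intro!]: "poly_bounded \<mu> (\<lambda>_. c)"
  unfolding poly_bounded_def by (intro exI[of _ c] exI[of _ 0]) simp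

lemma poly_bounded_self: "poly_bounded \<mu> \<mu>"
  unfolding poly_bounded_def by (intro exI[of _ 1] exI[of _ 1]) simp

lemma poly_bounded_mult [intro]:
  assumes "poly_bounded \<mu> g" "poly_bounded \<mu> h"
  shows "poly_bounded \<mu> (\<lambda>x. g x * h x)"
proof -
  from assms obtain C d C' d' where
    "\<And>x. g x \<le> C * Suc (\<mu> x) ^ d" "\<And>x. h x \<le> C' * Suc (\<mu> x) ^ d'"
    unfolding poly_bounded_def by blast
  then have "g x * h x \<le> (C * C') * Suc (\<mu> x) ^ (d + d')" for x
    using mult_mono[of "g x" "C * Suc (\<mu> x) ^ d" "h x" "C' * Suc (\<mu> x) ^ d'"]
    by (simp add: power_add mult_ac del: power_Suc)
  then show ?thesis unfolding poly_bounded_def by blast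
qed

lemma poly_bounded_add [intro]:
  assumes "poly_bounded \<mu> g" "poly_bounded \<mu> h"
  shows "poly_bounded \<mu> (\<lambda>x. g x + h x)"
proof -
  have "poly_bounded \<mu> (\<lambda>x. Suc (g x))" "poly_bounded \<mu> (\<lambda>x. Suc (h x))"
  proof -
    have *: "poly_bounded \<mu> (\<lambda>x. Suc (g x))" if "poly_bounded \<mu> g" for g :: "'a \<Rightarrow> nat"
    proof -
      from that obtain C d where le: "\<And>x. g x \<le> C * Suc (\<mu> x) ^ d"
        unfolding poly_bounded_def by blast
      have "Suc (g x) \<le> Suc C * Suc (\<mu> x) ^ d" for x
        using le[of x] one_le_power[of "Suc (\<mu> x)" d] unfolding mult_Suc by linarith
      then show ?thesis unfolding poly_bounded_def by blast
    qed
    show "poly_bounded \<mu> (\<lambda>x. Suc (g x))" "poly_bounded \<mu> (\<lambda>x. Suc (h x))" using * assms by auto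
  qed
  \<comment> \<open>\<open>g + h \<le> (g + 1) * (h + 1)\<close>, so the product settles the
    sum.\<close>
  from poly_bounded_mult[OF this] show ?thesis
    by (rule poly_bounded_mono) simp
qed

lemma poly_bounded_Suc [intro]: "poly_bounded \<mu> g \<Longrightarrow> poly_bounded \<mu> (\<lambda>x. Suc (g x))"
  using poly_bounded_add[of \<mu> g "\<lambda>_. 1"] by auto

lemma poly_bounded_power [intro]: "poly_bounded \<mu> g \<Longrightarrow> poly_bounded \<mu> (\<lambda>x. g x ^ d)"
  by (induction d) auto

lemma poly_bounded_comp:
  assumes "poly_bounded \<nu> h" "poly_bounded \<mu> (\<lambda>x. \<nu> (g x))"
  shows "poly_bounded \<mu> (\<lambda>x. h (g x))"
proof -
  from assms(1) obtain C d where "\<And>x. h x \<le> C * Suc (\<nu> x) ^ d"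
    unfolding poly_bounded_def by blast
  moreover have "poly_bounded \<mu> (\<lambda>x. C * Suc (\<nu> (g x)) ^ d)"
    using assms(2) by (intro poly_bounded_mult poly_bounded_power poly_bounded_const poly_bounded_Suc)
  ultimately show ?thesis by (blast intro: poly_bounded_mono)
qed

section \<open>Polynomial-time functions\<close>

text \<open>Variables between 1 and \<open>b\<close> may hold anything at the start, and those from
  \<open>b\<close> on survive. So the program can be repeated in a loop whose own data lie from
  \<open>b\<close> on.\<close>

definition realizes :: "com \<Rightarrow> nat \<Rightarrow> (val \<Rightarrow> val) \<Rightarrow> (val \<Rightarrow> nat) \<Rightarrow> bool" where
  "realizes c b f T \<longleftrightarrow> deterministic c \<and> 0 < b \<and>
     (\<forall>s. \<exists>t s'. t \<le> T (s 0) \<and> executes c s t s' \<and> s' 0 = f (s 0) \<and> (\<forall>y \<ge> b. s' y = s y))"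

text \<open>The time is measured in \<open>\<mu>\<close> and not in the size of the input because the reduction is
  polynomial only in the size of its output. The size of the result is bounded separately: since
  trees share subtrees, it can be exponential in the running time.\<close>

definition polytime :: "(val \<Rightarrow> nat) \<Rightarrow> (val \<Rightarrow> val) \<Rightarrow> bool" where
  "polytime \<mu> f \<longleftrightarrow> (\<exists>c b T. realizes c b f T \<and> poly_bounded \<mu> T) \<and> poly_bounded \<mu> (\<lambda>x. size (f x))"

lemma realizes_mono:
  assumes "realizes c b f T" "\<And>x. T x \<le> T' x" "b \<le> b'"
  shows "realizes c b' f T'"
  unfolding realizes_def
proof (intro conjI allI)
  show "deterministic c" "0 < b'" using assms unfolding realizes_def by auto
  fix s
  from assms(1) obtain t s' where "t \<le> T (s 0)" "executes c s t s'" "s' 0 = f (s 0)"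
    "\<forall>y \<ge> b. s' y = s y" unfolding realizes_def by blast
  then show "\<exists>t s'. t \<le> T' (s 0) \<and> executes c s t s' \<and> s' 0 = f (s 0) \<and> (\<forall>y \<ge> b'. s' y = s y)"
    using assms(2)[of "s 0"] assms(3) by (intro exI[of _ t] exI[of _ s']) auto
qed

lemma realizesE:
  assumes "realizes c b f T"
  obtains t s' where "t \<le> T (s 0)" "executes c s t s'" "s' 0 = f (s 0)" "\<And>y. y \<ge> b \<Longrightarrow> s' y = s y"
proof -
  from assms have "\<exists>t s'. t \<le> T (s 0) \<and> executes c s t s' \<and> s' 0 = f (s 0) \<and> (\<forall>y \<ge> b. s' y = s y)"
    unfolding realizes_def by simp
  then show ?thesis using that by blast
qed

section \<open>Closure under composition, pairing and case distinction\<close>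

lemma realizes_Assign:
  assumes "\<And>s. eval e s = f (s 0)"
  shows "realizes (Assign 0 e) 1 f (\<lambda>_. 1)"
  unfolding realizes_def using executes_Assign[of 0 e] assms by fastforce

fun exp_of :: "val \<Rightarrow> exp" where
  "exp_of Leaf = LeafE"
| "exp_of (Node a b) = NodeE (exp_of a) (exp_of b)"

lemma eval_exp_of [simp]: "eval (exp_of v) s = v"
  by (induction v) auto

lemma polytime_const: "polytime \<mu> (\<lambda>_. v)"
  unfolding polytime_def using realizes_Assign[of "exp_of v" "\<lambda>_. v"] by auto

lemma realizes_comp:
  assumes "realizes c b f T" "realizes c' b' g T'"
  shows "realizes (Seq c c') (max b b') (\<lambda>x. g (f x)) (\<lambda>x. Suc (T x + T' (f x)))"
  unfolding realizes_def
proof (intro conjI allI)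
  show "deterministic (Seq c c')" "0 < max b b'" using assms by (auto simp: realizes_def)
  fix s
  from assms(1) obtain t s1 where 1: "t \<le> T (s 0)" "executes c s t s1" "s1 0 = f (s 0)"
    "\<And>y. y \<ge> b \<Longrightarrow> s1 y = s y" by (rule realizesE[where s = s]) blast
  from assms(2) obtain t' s2 where 2: "t' \<le> T' (s1 0)" "executes c' s1 t' s2" "s2 0 = g (s1 0)"
    "\<And>y. y \<ge> b' \<Longrightarrow> s2 y = s1 y" by (rule realizesE[where s = s1]) blast
  show "\<exists>t s'. t \<le> Suc (T (s 0) + T' (f (s 0))) \<and> executes (Seq c c') s t s' \<and> s' 0 = g (f (s 0)) \<and>
      (\<forall>y \<ge> max b b'. s' y = s y)"
    using 1 2 executes_Seq[OF 1(2) 2(2)]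
    by (intro exI[of _ "Suc (t + t')"] exI[of _ s2]) auto
qed

text \<open>Two measures are needed for outer functions, such as enumeration, whose cost is not
  polynomial in the size of their argument: it suffices that their measure of the intermediate value
  is bounded in terms of the original input.\<close>

lemma polytime_comp_gen:
  assumes "polytime \<nu> g" "polytime \<mu> f" "poly_bounded \<mu> (\<lambda>x. \<nu> (f x))"
  shows "polytime \<mu> (\<lambda>x. g (f x))"
proof -
  from assms obtain c b T c' b' T' where
    r: "realizes c b f T" "realizes c' b' g T'" and p: "poly_bounded \<mu> T" "poly_bounded \<nu> T'"
    unfolding polytime_def by blast
  have "poly_bounded \<mu> (\<lambda>x. Suc (T x + T' (f x)))"
    using p poly_bounded_comp[of \<nu> T' \<mu> f, OF p(2) assms(3)] by (intro poly_bounded_Suc poly_bounded_add)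
  moreover have "poly_bounded \<mu> (\<lambda>x. size (g (f x)))"
    using poly_bounded_comp[of \<nu> "\<lambda>y. size (g y)" \<mu> f, OF _ assms(3)] assms(1) unfolding polytime_def by blast
  ultimately show ?thesis
    unfolding polytime_def using realizes_comp[OF r] by blast
qed

lemma polytime_comp: "polytime size g \<Longrightarrow> polytime \<mu> f \<Longrightarrow> polytime \<mu> (\<lambda>x. g (f x))"
  by (rule polytime_comp_gen) (auto simp: polytime_def)

lemma size_left: "size (left x) \<le> size x"
  by (cases x) auto

lemma size_right: "size (right x) \<le> size x"
  by (cases x) auto

lemma polytime_id: "poly_bounded \<mu> size \<Longrightarrow> polytime \<mu> (\<lambda>x. x)"
  unfolding polytime_def using realizes_Assign[of "Var 0" "\<lambda>x. x"] by auto

lemma polytime_left: "polytime \<mu> f \<Longrightarrow> polytime \<mu> (\<lambda>x. left (f x))"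
  by (rule polytime_comp[of left])
    (use realizes_Assign[of "Hd (Var 0)" left] poly_bounded_mono[OF poly_bounded_self size_left] in \<open>auto simp: polytime_def\<close>)

lemma polytime_right: "polytime \<mu> f \<Longrightarrow> polytime \<mu> (\<lambda>x. right (f x))"
  by (rule polytime_comp[of right])
    (use realizes_Assign[of "Tl (Var 0)" right] poly_bounded_mono[OF poly_bounded_self size_right] in \<open>auto simp: polytime_def\<close>)

lemma polytime_Node:
  assumes "polytime \<mu> f" "polytime \<mu> g"
  shows "polytime \<mu> (\<lambda>x. Node (f x) (g x))"
proof -
  from assms obtain c b T c' b' T' where
    "realizes c b f T" "realizes c' b' g T'" and p: "poly_bounded \<mu> T" "poly_bounded \<mu> T'"
    unfolding polytime_def by blast
  define B where "B = max b b'"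
  have r: "realizes c B f T" "realizes c' B g T'"
    using \<open>realizes c b f T\<close> \<open>realizes c' b' g T'\<close> by (auto simp: B_def intro: realizes_mono)
  then have B: "0 < B" by (simp add: realizes_def)
  \<comment> \<open>Both programs read variable 0 and may overwrite everything below
    \<open>B\<close>; hence the input waits in \<open>B\<close> and the first result in
    \<open>Suc B\<close>.\<close>
  define P where "P = Seq (Assign B (Var 0)) (Seq c (Seq (Assign (Suc B) (Var 0))
    (Seq (Assign 0 (Var B)) (Seq c' (Assign 0 (NodeE (Var (Suc B)) (Var 0)))))))"
  have "realizes P (Suc (Suc B)) (\<lambda>x. Node (f x) (g x)) (\<lambda>x. T x + T' x + 9)"
    unfolding realizes_def
  proof (intro conjI allI)
    show "deterministic P" "0 < Suc (Suc B)" using r by (auto simp: P_def realizes_def)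
    fix s :: store
    define s0 where "s0 = s(B := s 0)"
    have e0: "executes (Assign B (Var 0)) s 1 s0" using executes_Assign[of B "Var 0" s] by (simp add: s0_def)
    from r(1) obtain t s1 where 1: "t \<le> T (s0 0)" "executes c s0 t s1" "s1 0 = f (s0 0)"
      "\<And>y. y \<ge> B \<Longrightarrow> s1 y = s0 y" by (rule realizesE[where s = s0]) blast
    define s2 where "s2 = s1(Suc B := s1 0, 0 := s1 B)"
    have e1: "executes (Assign (Suc B) (Var 0)) s1 1 (s1(Suc B := s1 0))"
      using executes_Assign[of "Suc B" "Var 0" s1] by simp
    have e2: "executes (Assign 0 (Var B)) (s1(Suc B := s1 0)) 1 s2"
      using executes_Assign[of 0 "Var B" "s1(Suc B := s1 0)"] by (simp add: s2_def)
    from r(2) obtain t' s3 where 3: "t' \<le> T' (s2 0)" "executes c' s2 t' s3" "s3 0 = g (s2 0)"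
      "\<And>y. y \<ge> B \<Longrightarrow> s3 y = s2 y" by (rule realizesE[where s = s2]) blast
    define s4 where "s4 = s3(0 := Node (s3 (Suc B)) (s3 0))"
    have e4: "executes (Assign 0 (NodeE (Var (Suc B)) (Var 0))) s3 1 s4"
      using executes_Assign[of 0 "NodeE (Var (Suc B)) (Var 0)" s3] by (simp add: s4_def)
    have "executes P s (t + t' + 9) s4"
      unfolding P_def
      using executes_Seq[OF e0 executes_Seq[OF 1(2) executes_Seq[OF e1 executes_Seq[OF e2 executes_Seq[OF 3(2) e4]]]]]
      by (simp add: add_ac eval_nat_numeral)
    moreover have "s0 0 = s 0" using B by (simp add: s0_def)
    moreover have "s2 0 = s 0" using 1(4)[of B] by (simp add: s2_def s0_def)
    moreover have "s3 (Suc B) = f (s 0)" using 3(4)[of "Suc B"] 1(3) \<open>s0 0 = s 0\<close>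
      by (simp add: s2_def)
    moreover have "s4 y = s y" if "y \<ge> Suc (Suc B)" for y
      using that 3(4)[of y] 1(4)[of y] by (simp add: s4_def s2_def s0_def)
    ultimately show "\<exists>t s'. t \<le> T (s 0) + T' (s 0) + 9 \<and> executes P s t s' \<and>
        s' 0 = Node (f (s 0)) (g (s 0)) \<and> (\<forall>y \<ge> Suc (Suc B). s' y = s y)"
      using 1 3 by (intro exI[of _ "t + t' + 9"] exI[of _ s4]) (simp add: s4_def)
  qed
  moreover have "poly_bounded \<mu> (\<lambda>x. T x + T' x + 9)" using p by (intro poly_bounded_add poly_bounded_const)
  moreover have "poly_bounded \<mu> (\<lambda>x. size (Node (f x) (g x)))"
    using assms by (auto simp: polytime_def)
  ultimately show ?thesis unfolding polytime_def by blast
qed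

text \<open>All three functions are evaluated first, by pairing; what remains is a constant-time
  selection from a triple.\<close>

lemma polytime_If:
  assumes "polytime \<mu> f" "polytime \<mu> g" "polytime \<mu> h"
  shows "polytime \<mu> (\<lambda>x. if f x \<noteq> Leaf then g x else h x)"
proof -
  from polytime_Node[OF assms(1) polytime_Node[OF assms(2,3)]]
  have "polytime \<mu> (\<lambda>x. Node (f x) (Node (g x) (h x)))" .
  moreover have "polytime size (\<lambda>z. if left z \<noteq> Leaf then left (right z) else right (right z))"
  proof -
    let ?P = "If (Hd (Var 0)) (Assign 0 (Hd (Tl (Var 0)))) (Assign 0 (Tl (Tl (Var 0))))"
    have "realizes ?P 1 (\<lambda>z. if left z \<noteq> Leaf then left (right z) else right (right z)) (\<lambda>_. 2)"
      unfolding realizes_def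
    proof (intro conjI allI)
      fix s :: store
      let ?e = "if left (s 0) \<noteq> Leaf then Hd (Tl (Var 0)) else Tl (Tl (Var 0))"
      have "executes ?P s (Suc 1) (s(0 := eval ?e s))"
        by (rule executes_If) (use executes_Assign[of 0 ?e s] in auto)
      then show "\<exists>t s'. t \<le> 2 \<and> executes ?P s t s' \<and>
        s' 0 = (if left (s 0) \<noteq> Leaf then left (right (s 0)) else right (right (s 0))) \<and>
        (\<forall>y \<ge> 1. s' y = s y)"
        by (intro exI[of _ "Suc 1"] exI[of _ "s(0 := eval ?e s)"]) auto
    qed auto
    moreover have "poly_bounded size (\<lambda>z. size (if left z \<noteq> Leaf then left (right z) else right (right z)))"
    proof (rule poly_bounded_mono[OF poly_bounded_self])
      fix z :: val
      show "size (if left z \<noteq> Leaf then left (right z) else right (right z)) \<le> size z"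
        using size_left[of "right z"] size_right[of "right z"] size_right[of z] by auto
    qed
    ultimately show ?thesis unfolding polytime_def by blast
  qed
  ultimately show ?thesis
    using polytime_comp[of "\<lambda>z. if left z \<noteq> Leaf then left (right z) else right (right z)" \<mu>
      "\<lambda>x. Node (f x) (Node (g x) (h x))"]
    unfolding left.simps right.simps by blast
qed

section \<open>Iteration over lists\<close>

primrec vlist :: "val \<Rightarrow> val list" where
  "vlist Leaf = []"
| "vlist (Node a b) = a # vlist b"

text \<open>The body of a loop receives \<open>Node context (Node element state)\<close>; the functions named
  \<open>_step\<close> below take such a triple apart with \<open>left\<close> and \<open>right\<close>.\<close>

definition vfold :: "(val \<Rightarrow> val) \<Rightarrow> val \<Rightarrow> val" where
  "vfold B z = fold (\<lambda>h st. B (Node (left z) (Node h st))) (vlist (left (right z))) (right (right z))"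

lemma vlist_eq_Cons: "vlist x = h # hs \<Longrightarrow> x \<noteq> Leaf \<and> left x = h \<and> vlist (right x) = hs"
  by (cases x) auto

lemma vlist_eq_Nil: "vlist x = [] \<longleftrightarrow> x = Leaf"
  by (cases x) auto

lemma length_vlist: "length (vlist x) \<le> size x"
  by (induction x) auto

lemma size_vlist: "h \<in> set (vlist x) \<Longrightarrow> size h \<le> size x"
  by (induction x) auto

abbreviation vfold_prefix :: "(val \<Rightarrow> val) \<Rightarrow> val \<Rightarrow> nat \<Rightarrow> val" where
  "vfold_prefix B z i \<equiv> fold (\<lambda>h st. B (Node (left z) (Node h st))) (take i (vlist (left (right z))))
    (right (right z))"

text \<open>Variable 0 carries the state, \<open>b\<close> the context and \<open>Suc b\<close> the
  rest of the list; the last two are out of reach of \<open>c\<close>. A pass costs 5 steps besides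
  the body, and the failing final test costs 1.\<close>

lemma executes_fold_loop:
  assumes r: "realizes c b B T"
  defines "P \<equiv> While (Var (Suc b)) (Seq (Assign 0 (NodeE (Var b) (NodeE (Hd (Var (Suc b))) (Var 0))))
      (Seq c (Assign (Suc b) (Tl (Var (Suc b))))))"
  defines "F \<equiv> (\<lambda>ctx h st. B (Node ctx (Node h st)))"
  shows "vlist (s (Suc b)) = hs \<Longrightarrow> s b = ctx \<Longrightarrow>
    \<exists>t s'. t \<le> (\<Sum>i<length hs. T (Node ctx (Node (hs ! i) (fold (F ctx) (take i hs) (s 0)))) + 5) + 1 \<and>
      executes P s t s' \<and> s' 0 = fold (F ctx) hs (s 0) \<and> (\<forall>y \<ge> Suc (Suc b). s' y = s y)"
proof (induction hs arbitrary: s)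
  case Nil
  then have "eval (Var (Suc b)) s = Leaf" by (simp add: vlist_eq_Nil)
  then have "executes P s 1 s" unfolding P_def by (rule executes_While_False)
  then show ?case by (intro exI[of _ 1] exI[of _ s]) auto
next
  case (Cons h hs)
  have b: "0 < b" using r by (simp add: realizes_def)
  from vlist_eq_Cons[OF Cons.prems(1)]
  have s: "s (Suc b) \<noteq> Leaf" "left (s (Suc b)) = h" "vlist (right (s (Suc b))) = hs" by auto
  define s1 where "s1 = s(0 := Node ctx (Node h (s 0)))"
  have e1: "executes (Assign 0 (NodeE (Var b) (NodeE (Hd (Var (Suc b))) (Var 0)))) s 1 s1"
    using executes_Assign[of 0 "NodeE (Var b) (NodeE (Hd (Var (Suc b))) (Var 0))" s] s Cons.prems(2)
    by (simp add: s1_def)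
  from r obtain t s2 where 2: "t \<le> T (s1 0)" "executes c s1 t s2" "s2 0 = B (s1 0)"
    "\<And>y. y \<ge> b \<Longrightarrow> s2 y = s1 y" by (rule realizesE[where s = s1]) blast
  define s3 where "s3 = s2(Suc b := right (s2 (Suc b)))"
  have e3: "executes (Assign (Suc b) (Tl (Var (Suc b)))) s2 1 s3"
    using executes_Assign[of "Suc b" "Tl (Var (Suc b))" s2] by (simp add: s3_def)
  have "vlist (s3 (Suc b)) = hs" "s3 b = ctx"
    using 2(4)[of "Suc b"] 2(4)[of b] s b Cons.prems(2) by (auto simp: s3_def s1_def)
  from Cons.IH[OF this] obtain t' s' where
    3: "t' \<le> (\<Sum>i<length hs. T (Node ctx (Node (hs ! i) (fold (F ctx) (take i hs) (s3 0)))) + 5) + 1"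
    "executes P s3 t' s'" "s' 0 = fold (F ctx) hs (s3 0)" "\<forall>y \<ge> Suc (Suc b). s' y = s3 y"
    by blast
  have s30: "s3 0 = F ctx h (s 0)" using 2(3) by (simp add: s3_def s1_def F_def)
  have "executes P s (Suc (Suc (1 + Suc (t + 1)) + t')) s'"
    unfolding P_def
    by (rule executes_While_True[OF _ executes_Seq[OF e1 executes_Seq[OF 2(2) e3]] 3(2)[unfolded P_def]])
      (use s in simp)
  moreover have "Suc (Suc (1 + Suc (t + 1)) + t') \<le>
      (\<Sum>i<length (h # hs). T (Node ctx (Node ((h # hs) ! i)
        (fold (F ctx) (take i (h # hs)) (s 0)))) + 5) + 1"
    unfolding length_Cons sum.lessThan_Suc_shift
    using 3(1) 2(1) s30 by (simp add: s1_def del: sum.lessThan_Suc)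
  moreover have "\<forall>y \<ge> Suc (Suc b). s' y = s y"
    using 3(4) 2(4) by (simp add: s3_def s1_def)
  ultimately show ?case using 3(3) s30 by (intro exI conjI) auto
qed

lemma realizes_vfold:
  assumes r: "realizes c b B T"
  shows "\<exists>c' b'. realizes c' b' (vfold B)
    (\<lambda>z. (\<Sum>i<length (vlist (left (right z))).
        T (Node (left z) (Node (vlist (left (right z)) ! i) (vfold_prefix B z i))) + 5) + 7)"
proof -
  have b: "0 < b" using r by (simp add: realizes_def)
  let ?L = "While (Var (Suc b)) (Seq (Assign 0 (NodeE (Var b) (NodeE (Hd (Var (Suc b))) (Var 0))))
      (Seq c (Assign (Suc b) (Tl (Var (Suc b))))))"
  define P where "P = Seq (Assign b (Hd (Var 0))) (Seq (Assign (Suc b) (Hd (Tl (Var 0))))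
    (Seq (Assign 0 (Tl (Tl (Var 0)))) ?L))"
  have "realizes P (Suc (Suc b)) (vfold B) (\<lambda>z. (\<Sum>i<length (vlist (left (right z))).
        T (Node (left z) (Node (vlist (left (right z)) ! i) (vfold_prefix B z i))) + 5) + 7)"
    unfolding realizes_def
  proof (intro conjI allI)
    show "deterministic P" "0 < Suc (Suc b)" using r by (auto simp: P_def realizes_def)
    fix s :: store
    define s1 where "s1 = s(b := left (s 0))"
    define s2 where "s2 = s1(Suc b := left (right (s 0)))"
    define s3 where "s3 = s2(0 := right (right (s 0)))"
    have e1: "executes (Assign b (Hd (Var 0))) s 1 s1"
      using executes_Assign[of b "Hd (Var 0)" s] by (simp add: s1_def)
    have e2: "executes (Assign (Suc b) (Hd (Tl (Var 0)))) s1 1 s2"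
      using executes_Assign[of "Suc b" "Hd (Tl (Var 0))" s1] b by (simp add: s1_def s2_def)
    have e3: "executes (Assign 0 (Tl (Tl (Var 0)))) s2 1 s3"
      using executes_Assign[of 0 "Tl (Tl (Var 0))" s2] b by (simp add: s1_def s2_def s3_def)
    have s3: "vlist (s3 (Suc b)) = vlist (left (right (s 0)))" "s3 b = left (s 0)" "s3 0 = right (right (s 0))"
      using b by (auto simp: s1_def s2_def s3_def)
    from executes_fold_loop[OF r s3(1,2)] obtain t s' where
      t: "t \<le> (\<Sum>i<length (vlist (left (right (s 0)))).
        T (Node (left (s 0)) (Node (vlist (left (right (s 0))) ! i) (vfold_prefix B (s 0) i))) + 5) + 1" and
      e: "executes ?L s3 t s'" and s': "s' 0 = vfold B (s 0)" "\<forall>y \<ge> Suc (Suc b). s' y = s3 y"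
      unfolding s3(3) vfold_def by blast
    have "executes P s (t + 6) s'"
      unfolding P_def using executes_Seq[OF e1 executes_Seq[OF e2 executes_Seq[OF e3 e]]] by (simp add: add_ac eval_nat_numeral)
    with t s' show "\<exists>t s'. t \<le> (\<Sum>i<length (vlist (left (right (s 0)))).
        T (Node (left (s 0)) (Node (vlist (left (right (s 0))) ! i) (vfold_prefix B (s 0) i))) + 5) + 7 \<and>
        executes P s t s' \<and> s' 0 = vfold B (s 0) \<and> (\<forall>y \<ge> Suc (Suc b). s' y = s y)"
      by (intro exI[of _ "t + 6"] exI[of _ s']) (auto simp: s3_def s2_def s1_def)
  qed
  then show ?thesis by blast
qed

text \<open>A polynomial-time body alone is not enough: a body that doubles its state produces
  exponential size. Therefore a polynomial bound \<open>Q\<close> on all intermediate states is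
  demanded.\<close>

lemma polytime_vfold_bounded:
  assumes B: "polytime size B" and g: "poly_bounded \<mu> size" and Q: "poly_bounded \<mu> Q"
    and le: "\<And>z i. i \<le> length (vlist (left (right z))) \<Longrightarrow> size (vfold_prefix B z i) \<le> Q z"
  shows "polytime \<mu> (vfold B)"
proof -
  from B obtain c b T where r: "realizes c b B T" and T: "poly_bounded size T"
    unfolding polytime_def by blast
  from T obtain C d where Cd: "\<And>x. T x \<le> C * Suc (size x) ^ d" unfolding poly_bounded_def by blast
  from realizes_vfold[OF r] obtain c' b' where r': "realizes c' b' (vfold B)
    (\<lambda>z. (\<Sum>i<length (vlist (left (right z))).
        T (Node (left z) (Node (vlist (left (right z)) ! i) (vfold_prefix B z i))) + 5) + 7)" by blast
  let ?M = "\<lambda>z. size z * (C * Suc (size z + (size z + Q z + 1) + 1) ^ d + 5) + 7"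
  have sl: "size (left (right z)) \<le> size z" for z :: val
    using size_left[of "right z"] size_right[of z] by simp
  have "realizes c' b' (vfold B) ?M"
  proof (rule realizes_mono[OF r'])
    fix z :: val
    have "T (Node (left z) (Node (vlist (left (right z)) ! i) (vfold_prefix B z i))) + 5 \<le>
        C * Suc (size z + (size z + Q z + 1) + 1) ^ d + 5"
      if "i \<in> {..<length (vlist (left (right z)))}" for i
    proof -
      from that have i: "i < length (vlist (left (right z)))" by simp
      have "size (vlist (left (right z)) ! i) \<le> size z"
        using size_vlist[OF nth_mem[OF i]] sl[of z] by simp
      then have "size (Node (left z) (Node (vlist (left (right z)) ! i) (vfold_prefix B z i))) \<le>
          size z + (size z + Q z + 1) + 1"
        using size_left[of z] le[of i z] i by simp
      then have "C * Suc (size (Node (left z) (Node (vlist (left (right z)) ! i) (vfold_prefix B z i)))) ^ d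
        \<le> C * Suc (size z + (size z + Q z + 1) + 1) ^ d"
        by (intro mult_left_mono power_mono) simp_all
      with Cd[of "Node (left z) (Node (vlist (left (right z)) ! i) (vfold_prefix B z i))"]
      show ?thesis by linarith
    qed
    from sum_bounded_above[of "{..<length (vlist (left (right z)))}", OF this] have "(\<Sum>i<length (vlist (left (right z))).
        T (Node (left z) (Node (vlist (left (right z)) ! i) (vfold_prefix B z i))) + 5) \<le>
        length (vlist (left (right z))) * (C * Suc (size z + (size z + Q z + 1) + 1) ^ d + 5)"
      by (simp only: card_lessThan of_nat_id)
    also have "\<dots> \<le> size z * (C * Suc (size z + (size z + Q z + 1) + 1) ^ d + 5)"
      using length_vlist[of "left (right z)"] sl[of z] by (intro mult_right_mono) auto
    finally show "(\<Sum>i<length (vlist (left (right z))).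
        T (Node (left z) (Node (vlist (left (right z)) ! i) (vfold_prefix B z i))) + 5) + 7 \<le> ?M z" by simp
  qed simp
  moreover have "poly_bounded \<mu> ?M"
    by (intro poly_bounded_add poly_bounded_mult poly_bounded_power poly_bounded_Suc poly_bounded_const g Q)
  moreover have "poly_bounded \<mu> (\<lambda>z. size (vfold B z))"
  proof (rule poly_bounded_mono[OF Q])
    show "size (vfold B z) \<le> Q z" for z
      using le[of "length (vlist (left (right z)))" z] by (simp add: vfold_def)
  qed
  ultimately show ?thesis unfolding polytime_def by blast
qed

text \<open>If a pass adds an amount depending only on context and element, and not on the state,
  the growth cannot compound: the total is at most the number of passes times one
  polynomial.\<close>

lemma polytime_vfold:
  assumes B: "polytime size B" and A: "poly_bounded size A"
    and grow: "\<And>c h st. size (B (Node c (Node h st))) \<le> size st + A (Node c h)"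
  shows "polytime size (vfold B)"
proof -
  from A obtain C d where Cd: "\<And>x. A x \<le> C * Suc (size x) ^ d" unfolding poly_bounded_def by blast
  let ?A = "\<lambda>z. C * Suc (size z + size z + 1) ^ d"
  let ?Q = "\<lambda>z. size z + size z * ?A z"
  show ?thesis
  proof (rule polytime_vfold_bounded[OF B poly_bounded_self, of ?Q])
    show "poly_bounded size ?Q" by (intro poly_bounded_add poly_bounded_mult poly_bounded_power poly_bounded_Suc poly_bounded_const poly_bounded_self)
    fix z :: val and i
    assume "i \<le> length (vlist (left (right z)))"
    have sl: "size (left (right z)) \<le> size z"
      using size_left[of "right z"] size_right[of z] by simp
    have "i \<le> length (vlist (left (right z))) \<Longrightarrow>
      size (vfold_prefix B z i) \<le> size (right (right z)) + i * ?A z" for i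
    proof (induction i)
      case 0
      then show ?case by simp
    next
      case (Suc i)
      let ?h = "vlist (left (right z)) ! i"
      have "?h \<in> set (vlist (left (right z)))" using Suc.prems by simp
      then have "size ?h \<le> size z" using size_vlist sl order_trans by blast
      then have "C * Suc (size (Node (left z) ?h)) ^ d \<le> ?A z"
        using size_left[of z] by (intro mult_left_mono power_mono) simp_all
      then have "A (Node (left z) ?h) \<le> ?A z" using Cd[of "Node (left z) ?h"] by linarith
      moreover have "vfold_prefix B z (Suc i) = B (Node (left z) (Node ?h (vfold_prefix B z i)))"
        using Suc.prems by (simp add: take_Suc_conv_app_nth)
      ultimately show ?case
        using grow[of "left z" ?h "vfold_prefix B z i"] Suc.IH Suc.prems by simp
    qed
    from this[of i] \<open>i \<le> _\<close> have "size (vfold_prefix B z i) \<le> size (right (right z)) + i * ?A z" by simp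
    also have "\<dots> \<le> ?Q z"
      using size_right[of "right z"] size_right[of z] length_vlist[of "left (right z)"] sl
        \<open>i \<le> length (vlist (left (right z)))\<close>
      by (intro add_mono mult_right_mono) auto
    finally show "size (vfold_prefix B z i) \<le> ?Q z" .
  qed
qed

section \<open>The functions of the reduction\<close>

lemmas polytime_intros = polytime_const polytime_id polytime_left polytime_right polytime_Node polytime_If

abbreviation truth :: val where "truth \<equiv> Node Leaf Leaf"

definition bit_eq :: "val \<Rightarrow> val \<Rightarrow> val" where
  "bit_eq a b = (if a \<noteq> Leaf then (if b \<noteq> Leaf then truth else Leaf) else (if b \<noteq> Leaf then Leaf else truth))"

lemma polytime_bit_eq: "polytime \<mu> f \<Longrightarrow> polytime \<mu> g \<Longrightarrow> polytime \<mu> (\<lambda>x. bit_eq (f x) (g x))"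
  unfolding bit_eq_def by (intro polytime_intros)

lemma size_bit_eq: "size (bit_eq a b) \<le> 1"
  by (simp add: bit_eq_def)

lemma bit_eq_enc_bool [simp]: "bit_eq (enc_bool a) (enc_bool b) = enc_bool (a = b)"
  by (simp add: bit_eq_def enc_bool_def)

lemma enc_bool_eq_Leaf [simp]: "enc_bool b = Leaf \<longleftrightarrow> \<not> b"
  by (simp add: enc_bool_def)

lemma enc_nat_0 [simp]: "enc_nat 0 = Leaf"
  by (subst enc_nat.simps) simp

lemma left_enc_nat [simp]: "left (enc_nat n) = enc_bool (odd n)"
  by (subst enc_nat.simps) (simp add: enc_bool_def)

lemma right_enc_nat [simp]: "right (enc_nat n) = enc_nat (n div 2)"
  by (subst enc_nat.simps) simp

lemma enc_nat_eq_Leaf [simp]: "enc_nat n = Leaf \<longleftrightarrow> n = 0"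
  by (subst enc_nat.simps) simp

lemma enc_nat_double [simp]: "0 < n \<Longrightarrow> enc_nat (2 * n) = Node Leaf (enc_nat n)"
  by (subst enc_nat.simps) (simp add: enc_bool_def)

lemma enc_nat_Suc_double [simp]: "enc_nat (Suc (2 * n)) = Node truth (enc_nat n)"
  by (subst enc_nat.simps) (simp add: enc_bool_def)

lemma enc_nat_1 [simp]: "enc_nat 1 = Node truth Leaf" "enc_nat (Suc 0) = Node truth Leaf"
  using enc_nat_Suc_double[of 0] by simp_all

lemma vlist_enc_list [simp]: "vlist (enc_list e xs) = map e xs"
  by (induction xs) (auto simp: enc_list_def)

lemma enc_list_Nil [simp]: "enc_list e [] = Leaf"
  and enc_list_Cons [simp]: "enc_list e (x # xs) = Node (e x) (enc_list e xs)"
  by (auto simp: enc_list_def)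

lemma polytime_vfold_add_const:
  assumes "polytime size B" "\<And>c h st. size (B (Node c (Node h st))) \<le> size st + K"
  shows "polytime size (vfold B)"
  using assms(1) poly_bounded_const by (rule polytime_vfold) (rule assms(2))

lemma polytime_vfold_add_elem:
  assumes "polytime size B" "\<And>c h st. size (B (Node c (Node h st))) \<le> size st + (size h + K)"
  shows "polytime size (vfold B)"
proof (rule polytime_vfold[OF assms(1), of "\<lambda>z. size z + K"])
  show "poly_bounded size (\<lambda>z :: val. size z + K)" by (intro poly_bounded_add poly_bounded_self poly_bounded_const)
  show "size (B (Node c (Node h st))) \<le> size st + (size (Node c h) + K)" for c h st
    using assms(2)[of c h st] by simp
qed

lemma polytime_size: "polytime \<mu> f \<Longrightarrow> poly_bounded \<mu> (\<lambda>x. size (f x))"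
  by (simp add: polytime_def)

section \<open>Comparison and shifting of binary numbers\<close>

definition compare_step :: "val \<Rightarrow> val" where
  "compare_step z =
     Node (if left (right (right z)) \<noteq> Leaf
           then bit_eq (left (left (right (right (right z))))) (left (right (right (right (right z)))))
           else Leaf)
       (Node (right (left (right (right (right z))))) (right (right (right (right (right z))))))"

text \<open>\<open>u\<close> matters only by its length, the number of bits to be compared. One
  traversal yields both the equality of the residues and the two quotients. Exhausted numbers go on
  supplying zeros, since \<open>left Leaf\<close> and \<open>right Leaf\<close> are
  \<open>Leaf\<close>.\<close>

definition compare_bits :: "val \<Rightarrow> val \<Rightarrow> val \<Rightarrow> val" where
  "compare_bits u v x = vfold compare_step (Node Leaf (Node u (Node truth (Node v x))))"

lemma size_left_right: "size (left x) + size (right x) \<le> size x"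
  by (cases x) auto

lemma polytime_compare: "polytime size (vfold compare_step)"
proof (rule polytime_vfold_add_const)
  show "polytime size compare_step"
    unfolding compare_step_def[abs_def] by (intro polytime_intros polytime_bit_eq poly_bounded_self)
  show "size (compare_step (Node c (Node h st))) \<le> size st + 3" for c h st
    using size_left_right[of "right st"] size_right[of st] size_right[of "left (right st)"]
      size_right[of "right (right st)"]
      size_bit_eq[of "left (left (right st))" "left (right (right st))"]
    by (auto simp: compare_step_def)
qed

lemma polytime_compare_bits: "polytime \<mu> f \<Longrightarrow> polytime \<mu> g \<Longrightarrow> polytime \<mu> h \<Longrightarrow> polytime \<mu> (\<lambda>x. compare_bits (f x) (g x) (h x))"
  unfolding compare_bits_def by (rule polytime_comp[OF polytime_compare]) (intro polytime_intros)

lemma mod_two_power_Suc_eq: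
  fixes v x :: nat
  shows "v mod 2 ^ Suc L = x mod 2 ^ Suc L \<longleftrightarrow>
    odd v = odd x \<and> (v div 2) mod 2 ^ L = (x div 2) mod 2 ^ L"
proof -
  have *: "y mod 2 ^ Suc L = 2 * (y div 2 mod 2 ^ L) + y mod 2" for y :: nat
    using mod_mult2_eq[of y 2 "2 ^ L"] by simp
  have "2 * a + v mod 2 = 2 * c + x mod 2 \<longleftrightarrow> odd v = odd x \<and> a = c" for a c
    by presburger
  then show ?thesis unfolding * .
qed

lemma compare_fold:
  "fold (\<lambda>h st. compare_step (Node Leaf (Node h st))) us
      (Node (enc_bool b) (Node (enc_nat v) (enc_nat x))) =
    Node (enc_bool (b \<and> v mod 2 ^ length us = x mod 2 ^ length us))
      (Node (enc_nat (v div 2 ^ length us)) (enc_nat (x div 2 ^ length us)))"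
proof (induction us arbitrary: b v x)
  case (Cons u us)
  have "compare_step (Node Leaf (Node u (Node (enc_bool b) (Node (enc_nat v) (enc_nat x))))) =
      Node (enc_bool (b \<and> odd v = odd x)) (Node (enc_nat (v div 2)) (enc_nat (x div 2)))"
    by (cases b) (simp_all add: compare_step_def, simp add: enc_bool_def)
  then have "fold (\<lambda>h st. compare_step (Node Leaf (Node h st))) (u # us)
      (Node (enc_bool b) (Node (enc_nat v) (enc_nat x))) =
    fold (\<lambda>h st. compare_step (Node Leaf (Node h st))) us
      (Node (enc_bool (b \<and> odd v = odd x)) (Node (enc_nat (v div 2)) (enc_nat (x div 2))))"
    by simp
  also have "\<dots> = Node (enc_bool (b \<and> v mod 2 ^ Suc (length us) = x mod 2 ^ Suc (length us)))
      (Node (enc_nat (v div 2 ^ Suc (length us))) (enc_nat (x div 2 ^ Suc (length us))))"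
    unfolding Cons.IH mod_two_power_Suc_eq unfolding power_Suc div_mult2_eq by simp
  finally show ?case by (simp only: list.size add_0_right add_Suc_right)
qed simp

lemma compare_enc_nat:
  "compare_bits u (enc_nat v) (enc_nat x) =
    Node (enc_bool (v mod 2 ^ length (vlist u) = x mod 2 ^ length (vlist u)))
      (Node (enc_nat (v div 2 ^ length (vlist u))) (enc_nat (x div 2 ^ length (vlist u))))"
  using compare_fold[of "vlist u" True v x] by (simp add: compare_bits_def vfold_def enc_bool_def)

lemma less_two_power_length_enc_nat: "n < 2 ^ length (vlist (enc_nat n))"
proof (induction n rule: less_induct)
  case (less n)
  show ?case
  proof (cases "n = 0")
    case False
    then have "n div 2 < 2 ^ length (vlist (enc_nat (n div 2)))" using less by simp
    moreover have "length (vlist (enc_nat n)) = Suc (length (vlist (enc_nat (n div 2))))"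
      using False by (subst enc_nat.simps) simp
    ultimately show ?thesis by simp
  qed simp
qed

text \<open>Without leading zeros, rounding up to a power of two at most doubles a number. This loss
  reappears as the 2 in the exponent of \<open>num_verts_le\<close>.\<close>

lemma two_power_length_enc_nat_le: "0 < n \<Longrightarrow> 2 ^ length (vlist (enc_nat n)) \<le> 2 * n"
proof (induction n rule: less_induct)
  case (less n)
  have len: "length (vlist (enc_nat n)) = Suc (length (vlist (enc_nat (n div 2))))"
    using less.prems by (subst enc_nat.simps) simp
  show ?case
  proof (cases "n div 2 = 0")
    case True
    with less.prems show ?thesis unfolding len True by simp
  next
    case False
    with less have "2 ^ length (vlist (enc_nat (n div 2))) \<le> 2 * (n div 2)" by simp
    then show ?thesis unfolding len by simp
  qed
qed

text \<open>\<open>y\<close> is its own counter: the numbers must agree on the bits of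
  \<open>y\<close>, and nothing of \<open>x\<close> may remain beyond them.\<close>

definition nat_eq :: "val \<Rightarrow> val \<Rightarrow> val" where
  "nat_eq y x = (if right (right (compare_bits y y x)) \<noteq> Leaf then Leaf else left (compare_bits y y x))"

lemma polytime_nat_eq: "polytime \<mu> f \<Longrightarrow> polytime \<mu> g \<Longrightarrow> polytime \<mu> (\<lambda>x. nat_eq (f x) (g x))"
  unfolding nat_eq_def by (intro polytime_intros polytime_compare_bits)

lemma nat_eq_enc_nat [simp]: "nat_eq (enc_nat a) (enc_nat b) = enc_bool (a = b)"
proof -
  let ?L = "length (vlist (enc_nat a))"
  have a: "a mod 2 ^ ?L = a" using less_two_power_length_enc_nat[of a] by simp
  have "(b div 2 ^ ?L = 0 \<and> a = b mod 2 ^ ?L) \<longleftrightarrow> a = b"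
  proof
    assume "b div 2 ^ ?L = 0 \<and> a = b mod 2 ^ ?L"
    then show "a = b" using div_mult_mod_eq[of b "2 ^ ?L"] by simp
  next
    assume "a = b"
    with a show "b div 2 ^ ?L = 0 \<and> a = b mod 2 ^ ?L"
      using less_two_power_length_enc_nat[of a] by auto
  qed
  then show ?thesis by (auto simp: nat_eq_def compare_enc_nat a enc_bool_def)
qed

section \<open>Literals and clauses evaluated at a facility\<close>

definition lookup_step :: "val \<Rightarrow> val" where
  "lookup_step z =
     Node (if nat_eq (left (right z)) (left (left z)) \<noteq> Leaf
           then bit_eq (left (right (right (right z)))) (right (left z))
           else left (right (right z)))
       (right (right (right (right z))))"

text \<open>The keys in \<open>X\<close> and the bits of \<open>w\<close> are walked in parallel. A
  key that does not occur leaves the initial \<open>Leaf\<close>, that is, false.\<close>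

definition lookup :: "val \<Rightarrow> val \<Rightarrow> val \<Rightarrow> val \<Rightarrow> val" where
  "lookup X q b w = left (vfold lookup_step (Node (Node q b) (Node X (Node Leaf w))))"

lemma polytime_lookup:
  assumes "polytime \<mu> f" "polytime \<mu> g" "polytime \<mu> h" "polytime \<mu> i"
  shows "polytime \<mu> (\<lambda>x. lookup (f x) (g x) (h x) (i x))"
proof -
  have "polytime size (vfold lookup_step)"
  proof (rule polytime_vfold_add_const)
    show "polytime size lookup_step"
      unfolding lookup_step_def[abs_def] by (intro polytime_intros polytime_nat_eq polytime_bit_eq poly_bounded_self)
    show "size (lookup_step (Node c (Node h st))) \<le> size st + 2" for c h st
      using size_left_right[of "st"] size_right[of "right st"]
        size_bit_eq[of "left (right st)" "right c"]
      by (auto simp: lookup_step_def)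
  qed
  then show ?thesis
    unfolding lookup_def by (intro polytime_left polytime_comp[OF \<open>polytime size (vfold lookup_step)\<close>] polytime_Node polytime_const assms)
qed

primrec lookup_bit :: "nat list \<Rightarrow> nat \<Rightarrow> bool \<Rightarrow> nat \<Rightarrow> bool \<Rightarrow> bool" where
  "lookup_bit [] q b w r = r"
| "lookup_bit (y # ys) q b w r = lookup_bit ys q b (w div 2) (if y = q then odd w = b else r)"

lemma lookup_enc:
  "lookup (enc_list enc_nat xs) (enc_nat q) (enc_bool b) (enc_nat w) =
     enc_bool (lookup_bit xs q b w False)"
proof -
  have "left (fold (\<lambda>h st. lookup_step (Node (Node (enc_nat q) (enc_bool b)) (Node h st)))
      (map enc_nat xs) (Node (enc_bool r) (enc_nat w))) = enc_bool (lookup_bit xs q b w r)" for r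
  proof (induction xs arbitrary: r w)
    case (Cons y ys)
    have "lookup_step (Node (Node (enc_nat q) (enc_bool b))
        (Node (enc_nat y) (Node (enc_bool r) (enc_nat w)))) =
      Node (enc_bool (if y = q then odd w = b else r)) (enc_nat (w div 2))"
      by (auto simp: lookup_step_def)
    then show ?case using Cons.IH by simp
  qed simp
  from this[of False] show ?thesis by (simp add: lookup_def vfold_def enc_bool_def)
qed

lemma lookup_bit_notin: "q \<notin> set xs \<Longrightarrow> lookup_bit xs q b w r = r"
  by (induction xs arbitrary: w r) auto

text \<open>The last matching key wins, so it takes distinct keys to make the lookup a plain bit
  test.\<close>

lemma lookup_bit_nth:
  "distinct xs \<Longrightarrow> i < length xs \<Longrightarrow> lookup_bit xs (xs ! i) b w r \<longleftrightarrow> bit w i = b"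
proof (induction xs arbitrary: w r i)
  case (Cons y ys)
  then show ?case
    by (cases i) (auto simp: lookup_bit_notin bit_0 bit_Suc)
qed simp

text \<open>\<open>\<kappa>\<close> is \<open>K\<close> in unary. One comparison tells whether the
  variable belongs to the block of \<open>v\<close>, and supplies its position in the block and the
  word of values stored in \<open>v\<close>.\<close>

definition literal_holds :: "val \<Rightarrow> val \<Rightarrow> val \<Rightarrow> val \<Rightarrow> val" where
  "literal_holds \<kappa> X v l =
     (if left (compare_bits \<kappa> v (left l)) \<noteq> Leaf
      then lookup X (right (right (compare_bits \<kappa> v (left l)))) (right l) (left (right (compare_bits \<kappa> v (left l))))
      else Leaf)"

lemma polytime_literal_holds:
  assumes "polytime \<mu> f" "polytime \<mu> g" "polytime \<mu> h" "polytime \<mu> i"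
  shows "polytime \<mu> (\<lambda>x. literal_holds (f x) (g x) (h x) (i x))"
  unfolding literal_holds_def by (intro polytime_intros polytime_lookup polytime_compare_bits assms)

text \<open>The variables \<open>x\<close> with equal residue modulo \<open>2 ^ K\<close> form a block. The low \<open>K\<close> bits of
  a facility \<open>v\<close> select a block, the bits above them are the values of its variables, the position of
  \<open>x\<close> being that of \<open>x div 2 ^ K\<close> in \<open>xs\<close>.\<close>

definition sat_literal :: "nat \<Rightarrow> nat list \<Rightarrow> nat \<Rightarrow> literal \<Rightarrow> bool" where
  "sat_literal K xs v = (\<lambda>(x, b). v mod 2 ^ K = x mod 2 ^ K \<and>
     lookup_bit xs (x div 2 ^ K) b (v div 2 ^ K) False)"

abbreviation enc_literal :: "literal \<Rightarrow> val" where
  "enc_literal \<equiv> enc_prod enc_nat enc_bool"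

lemma literal_holds_enc:
  "literal_holds \<kappa> (enc_list enc_nat xs) (enc_nat v) (enc_literal l) =
     enc_bool (sat_literal (length (vlist \<kappa>)) xs v l)"
  by (cases l)
    (simp add: literal_holds_def sat_literal_def compare_enc_nat lookup_enc enc_prod_def,
      simp add: enc_bool_def)

definition clause_step :: "val \<Rightarrow> val" where
  "clause_step z =
     (if literal_holds (left (left (left z))) (right (left (left z))) (right (left z)) (left (right z)) \<noteq> Leaf
      then truth else right (right z))"

text \<open>The initial state puts the extra facility into every clause group:
  \<open>right v = Leaf\<close> means that the number is at most 1, and 0 is not a facility.\<close>

definition clause_holds :: "val \<Rightarrow> val \<Rightarrow> val \<Rightarrow> val" where
  "clause_holds c v C = vfold clause_step (Node (Node c v) (Node C (if right v \<noteq> Leaf then Leaf else truth)))"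

lemma polytime_clause_holds:
  assumes "polytime \<mu> f" "polytime \<mu> g" "polytime \<mu> h"
  shows "polytime \<mu> (\<lambda>x. clause_holds (f x) (g x) (h x))"
proof -
  have "polytime size (vfold clause_step)"
  proof (rule polytime_vfold_add_const)
    show "polytime size clause_step"
      unfolding clause_step_def[abs_def] by (intro polytime_intros polytime_literal_holds poly_bounded_self)
    show "size (clause_step (Node c (Node h st))) \<le> size st + 1" for c h st
      by (auto simp: clause_step_def)
  qed
  then show ?thesis
    unfolding clause_holds_def
    by (intro polytime_comp[OF \<open>polytime size (vfold clause_step)\<close>] polytime_Node polytime_If polytime_right polytime_const assms)
qed

lemma clause_holds_enc:
  "clause_holds (Node \<kappa> (enc_list enc_nat xs)) (enc_nat v) (enc_list enc_literal C) =
     enc_bool (v \<le> 1 \<or> (\<exists>l \<in> set C. sat_literal (length (vlist \<kappa>)) xs v l))"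
proof -
  have "fold (\<lambda>h st. clause_step (Node (Node (Node \<kappa> (enc_list enc_nat xs)) (enc_nat v)) (Node h st)))
      (map enc_literal C) (enc_bool r) =
    enc_bool (r \<or> (\<exists>l \<in> set C. sat_literal (length (vlist \<kappa>)) xs v l))" for r
  proof (induction C arbitrary: r)
    case (Cons l C)
    have "clause_step (Node (Node (Node \<kappa> (enc_list enc_nat xs)) (enc_nat v))
        (Node (enc_literal l) (enc_bool r))) =
      enc_bool (r \<or> sat_literal (length (vlist \<kappa>)) xs v l)"
      by (auto simp: clause_step_def literal_holds_enc enc_bool_def)
    then show ?case using Cons.IH by simp
  qed simp
  moreover have "(if right (enc_nat v) \<noteq> Leaf then Leaf else truth) = enc_bool (v \<le> 1)"
    by (auto simp: enc_bool_def)
  ultimately show ?thesis by (simp add: clause_holds_def vfold_def del: right_enc_nat)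
qed

section \<open>Groups of the instance\<close>

definition clause_member_step :: "val \<Rightarrow> val" where
  "clause_member_step z = (if clause_holds (left (left z)) (left (right z)) (right (left z)) \<noteq> Leaf
     then Node (left (right z)) (right (right z)) else right (right z))"

definition block_member_step :: "val \<Rightarrow> val" where
  "block_member_step z = (if (if right (left (right z)) \<noteq> Leaf
       then left (compare_bits (left (left z)) (left (right z)) (right (left z))) else truth) \<noteq> Leaf
     then Node (left (right z)) (right (right z)) else right (right z))"

lemma polytime_clause_member: "polytime size (vfold clause_member_step)"
proof (rule polytime_vfold_add_elem)
  show "polytime size clause_member_step"
    unfolding clause_member_step_def[abs_def] by (intro polytime_intros polytime_clause_holds poly_bounded_self)
  show "size (clause_member_step (Node c (Node h st))) \<le> size st + (size h + 1)" for c h st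
    by (auto simp: clause_member_step_def)
qed

lemma polytime_block_member: "polytime size (vfold block_member_step)"
proof (rule polytime_vfold_add_elem)
  show "polytime size block_member_step"
    unfolding block_member_step_def[abs_def] by (intro polytime_intros polytime_compare_bits poly_bounded_self)
  show "size (block_member_step (Node c (Node h st))) \<le> size st + (size h + 1)" for c h st
    by (auto simp: block_member_step_def)
qed

lemma fold_filter_enc:
  assumes "\<And>x st. x \<in> set xs \<Longrightarrow> F (e x) st = (if P x then Node (e x) st else st)"
  shows "fold F (map e xs) (enc_list e ys) = enc_list e (rev (filter P xs) @ ys)"
  using assms
proof (induction xs arbitrary: ys)
  case (Cons x xs)
  then show ?case using Cons.IH[of "x # ys"] by auto
qed simp

definition clause_group :: "nat \<Rightarrow> nat list \<Rightarrow> literal list \<Rightarrow> nat list \<Rightarrow> nat list" where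
  "clause_group K xs C V = rev (filter (\<lambda>v. v \<le> 1 \<or> (\<exists>l \<in> set C. sat_literal K xs v l)) V)"

definition block_group :: "nat \<Rightarrow> nat \<Rightarrow> nat list \<Rightarrow> nat list" where
  "block_group K j V = rev (filter (\<lambda>v. v \<le> 1 \<or> v mod 2 ^ K = j mod 2 ^ K) V)"

lemma clause_member_enc:
  "vfold clause_member_step (Node (Node (Node \<kappa> (enc_list enc_nat xs)) (enc_list enc_literal C))
      (Node (enc_list enc_nat V) Leaf)) =
    enc_list enc_nat (clause_group (length (vlist \<kappa>)) xs C V)"
proof -
  have "fold (\<lambda>h st. clause_member_step (Node (Node (Node \<kappa> (enc_list enc_nat xs)) (enc_list enc_literal C))
      (Node h st))) (map enc_nat V) (enc_list enc_nat []) =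
    enc_list enc_nat (clause_group (length (vlist \<kappa>)) xs C V @ [])"
    unfolding clause_group_def by (rule fold_filter_enc) (auto simp: clause_member_step_def clause_holds_enc)
  then show ?thesis by (simp add: vfold_def)
qed

lemma block_member_enc:
  "vfold block_member_step (Node (Node \<kappa> (enc_nat j)) (Node (enc_list enc_nat V) Leaf)) =
    enc_list enc_nat (block_group (length (vlist \<kappa>)) j V)"
proof -
  have "fold (\<lambda>h st. block_member_step (Node (Node \<kappa> (enc_nat j)) (Node h st)))
      (map enc_nat V) (enc_list enc_nat []) =
    enc_list enc_nat (block_group (length (vlist \<kappa>)) j V @ [])"
    unfolding block_group_def by (rule fold_filter_enc) (auto simp: block_member_step_def compare_enc_nat)
  then show ?thesis by (simp add: vfold_def)
qed

abbreviation enc_group :: "nat list \<times> int \<times> int \<Rightarrow> val" where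
  "enc_group \<equiv> enc_prod (enc_list enc_nat) (enc_prod enc_int enc_int)"

definition block_group_step :: "val \<Rightarrow> val" where
  "block_group_step z = Node (Node (vfold block_member_step (Node (Node (left (left z)) (left (right z)))
       (Node (right (left z)) Leaf))) (enc_prod enc_int enc_int (0, 1))) (right (right z))"

text \<open>\<open>Node Leaf\<close> supplies the non-negative sign that \<open>enc_int\<close> puts
  before a number. With the budget as upper bound, the group just demands at least one
  element.\<close>

definition clause_group_step :: "val \<Rightarrow> val" where
  "clause_group_step z = Node (Node (vfold clause_member_step (Node (Node (left (left z)) (left (right z)))
       (Node (left (right (left z))) Leaf))) (Node (enc_int 1) (Node Leaf (right (right (left z))))))
     (right (right z))"

lemma polytime_block_groups: "polytime size (vfold block_group_step)"
proof (rule polytime_vfold)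
  show "polytime size block_group_step"
    unfolding block_group_step_def[abs_def] by (intro polytime_intros polytime_comp[OF polytime_block_member] poly_bounded_self)
  \<comment> \<open>The list entry produced by one pass. It does not depend on the state, so the
    size bound from its own polynomial-time proof serves as the additive growth.\<close>
  let ?f = "\<lambda>z. Node (vfold block_member_step (Node (Node (left (left z)) (right z))
       (Node (right (left z)) Leaf))) (enc_prod enc_int enc_int (0, 1))"
  show "poly_bounded size (\<lambda>z. size (Node (?f z) Leaf))"
    by (rule polytime_size) (intro polytime_intros polytime_comp[OF polytime_block_member] poly_bounded_self)
  show "size (block_group_step (Node c (Node h st))) \<le> size st + size (Node (?f (Node c h)) Leaf)" for c h st
    by (simp add: block_group_step_def)
qed

lemma polytime_clause_groups: "polytime size (vfold clause_group_step)"
proof (rule polytime_vfold)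
  show "polytime size clause_group_step"
    unfolding clause_group_step_def[abs_def] by (intro polytime_intros polytime_comp[OF polytime_clause_member] poly_bounded_self)
  let ?f = "\<lambda>z. Node (vfold clause_member_step (Node (Node (left (left z)) (right z))
       (Node (left (right (left z))) Leaf))) (Node (enc_int 1) (Node Leaf (right (right (left z)))))"
  show "poly_bounded size (\<lambda>z. size (Node (?f z) Leaf))"
    by (rule polytime_size) (intro polytime_intros polytime_comp[OF polytime_clause_member] poly_bounded_self)
  show "size (clause_group_step (Node c (Node h st))) \<le> size st + size (Node (?f (Node c h)) Leaf)" for c h st
    by (simp add: clause_group_step_def)
qed

lemma fold_cons_enc:
  assumes "\<And>x st. x \<in> set xs \<Longrightarrow> F (e x) st = Node (d (g x)) st"
  shows "fold F (map e xs) (enc_list d ys) = enc_list d (rev (map g xs) @ ys)"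
  using assms
proof (induction xs arbitrary: ys)
  case (Cons x xs)
  then show ?case using Cons.IH[of "g x # ys"] by auto
qed simp

lemma block_groups_enc:
  "vfold block_group_step (Node (Node \<kappa> (enc_list enc_nat V)) (Node (enc_list enc_nat J) Leaf)) =
    enc_list enc_group (rev (map (\<lambda>j. (block_group (length (vlist \<kappa>)) j V, 0, 1)) J))"
proof -
  have "fold (\<lambda>h st. block_group_step (Node (Node \<kappa> (enc_list enc_nat V)) (Node h st)))
      (map enc_nat J) (enc_list enc_group []) =
    enc_list enc_group (rev (map (\<lambda>j. (block_group (length (vlist \<kappa>)) j V, 0, 1)) J) @ [])"
    by (rule fold_cons_enc) (simp add: block_group_step_def block_member_enc enc_prod_def)
  then show ?thesis by (simp add: vfold_def)
qed

lemma clause_groups_enc: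
  "vfold clause_group_step (Node (Node (Node \<kappa> (enc_list enc_nat xs)) (Node (enc_list enc_nat V) (enc_nat k)))
      (Node (enc_list (enc_list enc_literal) \<phi>) (enc_list enc_group gs))) =
    enc_list enc_group
      (rev (map (\<lambda>C. (clause_group (length (vlist \<kappa>)) xs C V, 1, int k)) \<phi>) @ gs)"
proof -
  have "fold (\<lambda>h st. clause_group_step (Node (Node (Node \<kappa> (enc_list enc_nat xs))
      (Node (enc_list enc_nat V) (enc_nat k))) (Node h st)))
      (map (enc_list enc_literal) \<phi>) (enc_list enc_group gs) =
    enc_list enc_group
      (rev (map (\<lambda>C. (clause_group (length (vlist \<kappa>)) xs C V, 1, int k)) \<phi>) @ gs)"
    by (rule fold_cons_enc) (simp add: clause_group_step_def clause_member_enc enc_prod_def enc_int_def enc_bool_def)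
  then show ?thesis by (simp add: vfold_def)
qed

section \<open>Edges, powers of two and counters\<close>

definition edge_step :: "val \<Rightarrow> val" where
  "edge_step z = Node (Node (Node Leaf (left (right z)))
       (if right (left (right z)) \<noteq> Leaf then enc_rat 1 else left z)) (right (right z))"

lemma polytime_edges: "polytime size (vfold edge_step)"
proof (rule polytime_vfold)
  show "polytime size edge_step"
    unfolding edge_step_def[abs_def] by (intro polytime_intros poly_bounded_self)
  show "poly_bounded size (\<lambda>z :: val. size z + (size (enc_rat 1) + 3))" by (intro poly_bounded_add poly_bounded_self poly_bounded_const)
  show "size (edge_step (Node c (Node h st))) \<le> size st + (size (Node c h) + (size (enc_rat 1) + 3))"
    for c h st
    by (simp add: edge_step_def)
qed

abbreviation enc_edge :: "(nat \<times> nat) \<times> rat \<Rightarrow> val" where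
  "enc_edge \<equiv> enc_prod (enc_prod enc_nat enc_nat) enc_rat"

lemma edges_enc:
  "vfold edge_step (Node (enc_rat D) (Node (enc_list enc_nat V) Leaf)) =
    enc_list enc_edge (rev (map (\<lambda>v. ((0, v), if v \<le> 1 then D else 1)) V))"
proof -
  have "fold (\<lambda>h st. edge_step (Node (enc_rat D) (Node h st)))
      (map enc_nat V) (enc_list enc_edge []) =
    enc_list enc_edge (rev (map (\<lambda>v. ((0, v), if v \<le> 1 then D else 1)) V) @ [])"
    by (rule fold_cons_enc) (auto simp: edge_step_def enc_prod_def)
  then show ?thesis by (simp add: vfold_def)
qed

definition double_step :: "val \<Rightarrow> val" where "double_step z = Node Leaf (right (right z))"

definition pow2 :: "val \<Rightarrow> val" where "pow2 u = vfold double_step (Node Leaf (Node u (enc_nat 1)))"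

lemma polytime_pow2: "polytime \<mu> f \<Longrightarrow> polytime \<mu> (\<lambda>x. pow2 (f x))"
proof -
  have "polytime size (vfold double_step)"
  proof (rule polytime_vfold_add_const)
    show "polytime size double_step" unfolding double_step_def[abs_def] by (intro polytime_intros poly_bounded_self)
    show "size (double_step (Node c (Node h st))) \<le> size st + 1" for c h st
      by (simp add: double_step_def)
  qed
  then show "polytime \<mu> f \<Longrightarrow> polytime \<mu> (\<lambda>x. pow2 (f x))"
    unfolding pow2_def by (intro polytime_comp[OF \<open>polytime size (vfold double_step)\<close>] polytime_Node polytime_const)
qed

lemma pow2_eq: "pow2 u = enc_nat (2 ^ length (vlist u))"
proof -
  have "fold (\<lambda>h st. double_step (Node Leaf (Node h st))) us (enc_nat n) =
      enc_nat (2 ^ length us * n)" if "0 < n" for us n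
    using that
  proof (induction us arbitrary: n)
    case (Cons u us)
    have "double_step (Node Leaf (Node u (enc_nat n))) = enc_nat (2 * n)"
      using Cons.prems by (simp add: double_step_def)
    then show ?case using Cons.IH[of "2 * n"] Cons.prems by (simp add: mult_ac)
  qed simp
  from this[of 1] show ?thesis by (simp add: pow2_def vfold_def)
qed

definition drop_step :: "val \<Rightarrow> val" where "drop_step z = right (right (right z))"

definition drop_bits :: "val \<Rightarrow> val \<Rightarrow> val" where "drop_bits u x = vfold drop_step (Node Leaf (Node u x))"

lemma polytime_drop_bits: "polytime \<mu> f \<Longrightarrow> polytime \<mu> g \<Longrightarrow> polytime \<mu> (\<lambda>x. drop_bits (f x) (g x))"
proof -
  have "polytime size (vfold drop_step)"
  proof (rule polytime_vfold_add_const)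
    show "polytime size drop_step" unfolding drop_step_def[abs_def] by (intro polytime_intros poly_bounded_self)
    show "size (drop_step (Node c (Node h st))) \<le> size st + 0" for c h st
      using size_right[of st] by (simp add: drop_step_def)
  qed
  then show "polytime \<mu> f \<Longrightarrow> polytime \<mu> g \<Longrightarrow> polytime \<mu> (\<lambda>x. drop_bits (f x) (g x))"
    unfolding drop_bits_def by (intro polytime_comp[OF \<open>polytime size (vfold drop_step)\<close>] polytime_Node polytime_const)
qed

lemma vlist_right: "vlist (right x) = tl (vlist x)"
  by (cases x) auto

lemma length_vlist_drop_bits: "length (vlist (drop_bits u x)) = length (vlist x) - length (vlist u)"
proof -
  have "length (vlist (fold (\<lambda>h st. drop_step (Node Leaf (Node h st))) us x)) =
      length (vlist x) - length us" for us
    by (induction us arbitrary: x) (auto simp: drop_step_def vlist_right)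
  then show ?thesis by (simp add: drop_bits_def vfold_def)
qed

definition append_step :: "val \<Rightarrow> val" where "append_step z = right z"

definition append_val :: "val \<Rightarrow> val \<Rightarrow> val" where "append_val u x = vfold append_step (Node Leaf (Node u x))"

lemma polytime_append_val: "polytime \<mu> f \<Longrightarrow> polytime \<mu> g \<Longrightarrow> polytime \<mu> (\<lambda>x. append_val (f x) (g x))"
proof -
  have "polytime size (vfold append_step)"
  proof (rule polytime_vfold_add_elem)
    show "polytime size append_step" unfolding append_step_def[abs_def] by (intro polytime_intros poly_bounded_self)
    show "size (append_step (Node c (Node h st))) \<le> size st + (size h + 1)" for c h st
      by (simp add: append_step_def)
  qed
  then show "polytime \<mu> f \<Longrightarrow> polytime \<mu> g \<Longrightarrow> polytime \<mu> (\<lambda>x. append_val (f x) (g x))"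
    unfolding append_val_def by (intro polytime_comp[OF \<open>polytime size (vfold append_step)\<close>] polytime_Node polytime_const)
qed

lemma length_vlist_append_val: "length (vlist (append_val u x)) = length (vlist u) + length (vlist x)"
proof -
  have "length (vlist (fold (\<lambda>h st. append_step (Node Leaf (Node h st))) us x)) =
      length us + length (vlist x)" for us
    by (induction us arbitrary: x) (auto simp: append_step_def)
  then show ?thesis by (simp add: append_val_def vfold_def)
qed

section \<open>Enumeration of the positive numbers below a power of two\<close>

definition enum_step :: "val \<Rightarrow> val" where
  "enum_step z = Node (Node Leaf (left (right z))) (Node (Node truth (left (right z))) (right (right z)))"

definition enum_round :: "val \<Rightarrow> val" where
  "enum_round z = vfold enum_step (Node Leaf (Node (right (right z)) (Node (enc_nat 1) Leaf)))"

definition enum :: "val \<Rightarrow> val" where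
  "enum u = vfold enum_round (Node Leaf (Node u Leaf))"

text \<open>Each number above 1 is \<open>2 * v\<close> or \<open>Suc (2 * v)\<close> for exactly
  one positive \<open>v\<close>, so a round doubles the range. Zero is kept out because putting a
  zero bit in front of \<open>enc_nat 0\<close> would not encode 0.\<close>

primrec nats :: "nat \<Rightarrow> nat list" where
  "nats 0 = []"
| "nats (Suc m) = fold (\<lambda>v acc. 2 * v # Suc (2 * v) # acc) (nats m) [1]"

lemma fold_double:
  "fold (\<lambda>v acc. 2 * v # Suc (2 * v) # acc) xs acc =
    rev (concat (map (\<lambda>v. [Suc (2 * v), 2 * v]) xs)) @ acc"
  by (induction xs arbitrary: acc) auto

lemma set_nats: "set (nats m) = {1..<2 ^ m}"
proof (induction m)
  case (Suc m)
  have "set (nats (Suc m)) = insert 1 (\<Union>v \<in> {1..<2 ^ m}. {Suc (2 * v), 2 * v})"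
    using Suc by (auto simp: fold_double)
  also have "\<dots> = {1..<2 ^ Suc m}"
  proof (intro equalityI subsetI)
    fix x :: nat assume "x \<in> {1..<2 ^ Suc m}"
    then have "x = 1 \<or> x div 2 \<in> {1..<2 ^ m}" by auto
    moreover have "x = 2 * (x div 2) \<or> x = Suc (2 * (x div 2))" by presburger
    ultimately show "x \<in> insert 1 (\<Union>v \<in> {1..<2 ^ m}. {Suc (2 * v), 2 * v})" by blast
  next
    have "Suc 0 < 2 * 2 ^ m" using zero_less_power[of "2 :: nat" m] by linarith
    then show "x \<in> {1..<2 ^ Suc m}"
      if "x \<in> insert 1 (\<Union>v \<in> {1..<2 ^ m}. {Suc (2 * v), 2 * v})" for x
      using that by auto
  qed
  finally show ?case .
qed simp

lemma length_nats: "length (nats m) = 2 ^ m - 1"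
proof (induction m)
  case (Suc m)
  have "length (nats (Suc m)) = Suc (2 * length (nats m))"
    by (simp add: fold_double length_concat comp_def sum_list_triv)
  then have "Suc (length (nats (Suc m))) = 2 * Suc (length (nats m))" by simp
  also have "Suc (length (nats m)) = 2 ^ m" using Suc by simp
  finally show ?case by simp
qed simp

lemma distinct_nats: "distinct (nats m)"
  by (rule card_distinct) (simp add: set_nats length_nats)

lemma enum_eq: "enum u = enc_list enc_nat (nats (length (vlist u)))"
proof -
  have step: "enum_round (Node Leaf (Node h (enc_list enc_nat (nats m)))) = enc_list enc_nat (nats (Suc m))"
    for h m
  proof -
    have "fold (\<lambda>h st. enum_step (Node Leaf (Node h st))) (map enc_nat xs) (enc_list enc_nat acc) =
        enc_list enc_nat (fold (\<lambda>v acc. 2 * v # Suc (2 * v) # acc) xs acc)"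
      if "0 \<notin> set xs" for xs acc
      using that
    proof (induction xs arbitrary: acc)
      case (Cons x xs)
      then show ?case using Cons.IH[of "2 * x # Suc (2 * x) # acc"] by (simp add: enum_step_def)
    qed simp
    from this[of "nats m" "[1]"] show ?thesis by (simp add: enum_round_def vfold_def set_nats)
  qed
  have "fold (\<lambda>h st. enum_round (Node Leaf (Node h st))) us (enc_list enc_nat (nats m)) =
      enc_list enc_nat (nats (m + length us))" for us m
    by (induction us arbitrary: m) (simp_all add: step del: nats.simps)
  from this[of "vlist u" 0] show ?thesis by (simp add: enum_def vfold_def)
qed

lemma polytime_enum_step: "polytime size (vfold enum_step)"
proof (rule polytime_vfold[of _ "\<lambda>z. 2 * size z + 6"])
  show "polytime size enum_step"
    unfolding enum_step_def[abs_def] by (intro polytime_intros poly_bounded_self)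
  show "poly_bounded size (\<lambda>z :: val. 2 * size z + 6)" by (intro poly_bounded_add poly_bounded_mult poly_bounded_self poly_bounded_const)
  show "size (enum_step (Node c (Node h st))) \<le> size st + (2 * size (Node c h) + 6)" for c h st
    by (simp add: enum_step_def)
qed

lemma size_enum_round:
  "size (enum_round (Node c (Node h st))) \<le> 10 * size st + 10"
proof -
  have "size (fold (\<lambda>h st. enum_step (Node Leaf (Node h st))) (vlist u) acc) \<le> 10 * size u + size acc"
    for u acc
  proof (induction u arbitrary: acc)
    case (Node a u)
    from Node(2)[of "enum_step (Node Leaf (Node a acc))"] show ?case
      by (simp add: enum_step_def)
  qed simp
  from this[of st "Node (enc_nat 1) Leaf"] show ?thesis
    by (simp add: enum_round_def vfold_def)
qed

text \<open>The result is exponentially long in \<open>length (vlist u)\<close>, hence the second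
  summand of the measure. The state grows by a factor in each round, so the additive criterion
  \<open>polytime_vfold\<close> does not apply.\<close>

lemma polytime_enum: "polytime (\<lambda>u. size u + 2 ^ length (vlist u)) enum"
proof -
  let ?\<mu> = "\<lambda>z. size z + 2 ^ length (vlist (left (right z)))"
  let ?Q = "\<lambda>z. ?\<mu> z ^ 5 * (size z + 2)"
  have "polytime ?\<mu> (vfold enum_round)"
  proof (rule polytime_vfold_bounded[where Q = ?Q])
    show "polytime size enum_round"
      unfolding enum_round_def[abs_def] by (intro polytime_intros polytime_comp[OF polytime_enum_step] poly_bounded_self)
    show "poly_bounded ?\<mu> size" by (rule poly_bounded_mono[OF poly_bounded_self]) simp
    then show "poly_bounded ?\<mu> ?Q" by (intro poly_bounded_mult poly_bounded_power poly_bounded_add poly_bounded_self poly_bounded_const)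
    fix z :: val and i
    assume i: "i \<le> length (vlist (left (right z)))"
    \<comment> \<open>A round multiplies the size by about 10. Rounding this up to 32 = 2 ^ 5 turns
      the growth over \<open>i\<close> rounds into the fifth power of \<open>2 ^ i\<close>.\<close>
    have "i \<le> length (vlist (left (right z))) \<Longrightarrow> size (vfold_prefix enum_round z i) + 2 \<le> 32 ^ i * (size z + 2)"
    proof (induction i)
      case 0
      then show ?case using size_right[of "right z"] size_right[of z] by simp
    next
      case (Suc i)
      have "vfold_prefix enum_round z (Suc i) =
          enum_round (Node (left z) (Node (vlist (left (right z)) ! i) (vfold_prefix enum_round z i)))"
        using Suc.prems by (simp add: take_Suc_conv_app_nth)
      with size_enum_round[of "left z" "vlist (left (right z)) ! i" "vfold_prefix enum_round z i"]
      show ?case using Suc by simp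
    qed
    with i have "size (vfold_prefix enum_round z i) \<le> 32 ^ i * (size z + 2)" by simp
    also have "(32 :: nat) ^ i = (2 ^ i) ^ 5" 
      using power_mult[of "2 :: nat" 5 i] power_mult[of "2 :: nat" i 5] by (simp add: mult.commute)
    also have "(2 ^ i) ^ 5 * (size z + 2) \<le> ?Q z"
    proof (intro mult_right_mono power_mono)
      show "2 ^ i \<le> ?\<mu> z"
        using power_increasing[OF i, of "2 :: nat"] by linarith
    qed auto
    finally show "size (vfold_prefix enum_round z i) \<le> ?Q z" .
  qed
  note vfold = this
  have *: "poly_bounded (\<lambda>u. size u + 2 ^ length (vlist u)) size"
    by (rule poly_bounded_mono[OF poly_bounded_self]) simp
  show ?thesis
    unfolding enum_def[abs_def]
  proof (rule polytime_comp_gen[OF vfold])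
    show "polytime (\<lambda>u. size u + 2 ^ length (vlist u)) (\<lambda>x. Node Leaf (Node x Leaf))"
      using * by (intro polytime_Node polytime_const polytime_id)
    show "poly_bounded (\<lambda>u. size u + 2 ^ length (vlist u)) (\<lambda>x. ?\<mu> (Node Leaf (Node x Leaf)))"
      by (rule poly_bounded_mono[OF poly_bounded_add[OF poly_bounded_self poly_bounded_const[of _ 2]]]) simp
  qed
qed

section \<open>The reduction\<close>

text \<open>The possible positions \<open>x div 2 ^ K\<close> of a variable inside its block.
  Rounding \<open>N\<close> up to a power of two makes this range computable from the bit length of
  \<open>N\<close> alone.\<close>

definition vars :: "nat \<Rightarrow> nat \<Rightarrow> nat list" where
  "vars K N = 0 # nats (length (vlist (enc_nat N)) - K)"

text \<open>\<open>K\<close> bits name a block and one bit per variable gives its values. The spare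
  top bit, once set, gives every assignment of a block a code other than 0, the centre, and 1, the
  extra facility.\<close>

definition num_bits :: "nat \<Rightarrow> nat \<Rightarrow> nat" where
  "num_bits K N = Suc (K + length (vars K N))"

text \<open>Each \<open>rev\<close> reproduces the order in which the loops build their lists, so
  that the output of the program is literally the encoding of this instance.\<close>

definition reduct :: "nat \<Rightarrow> nat \<Rightarrow> cnf \<Rightarrow> fr_instance" where
  "reduct K N \<phi> =
     \<lparr>budget = 2 ^ K,
      num_verts = 2 ^ num_bits K N,
      edges = rev (map (\<lambda>v. ((0, v), if v \<le> 1 then 2 ^ (2 ^ num_bits K N - 1) else 1)) (nats (num_bits K N))),
      clients = [0],
      facilities = nats (num_bits K N),
      groups = rev (map (\<lambda>C. (clause_group K (vars K N) C (nats (num_bits K N)), 1, int (2 ^ K))) \<phi>) @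
        rev (map (\<lambda>j. (block_group K j (nats (num_bits K N)), 0, 1)) (0 # nats K))\<rparr>"

definition vars_val :: "val \<Rightarrow> val" where
  "vars_val x = Node Leaf (enum (drop_bits (left x) (left (right x))))"

text \<open>A counter whose length is \<open>num_bits\<close>: \<open>Node Leaf\<close> accounts for
  the spare bit, \<open>left x\<close> for the block number, the list of variables for their
  values.\<close>

definition num_bits_val :: "val \<Rightarrow> val" where
  "num_bits_val x = Node Leaf (append_val (left x) (vars_val x))"

text \<open>All exponentially long lists are produced in this stage; the remaining construction is
  polynomial in the ordinary size of its result.\<close>

definition reduce_expand :: "val \<Rightarrow> val" where
  "reduce_expand x = Node (left x) (Node (vars_val x) (Node (num_bits_val x) (Node (enum (num_bits_val x))
     (Node (Node Leaf (enum (left x))) (right (right x))))))"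

text \<open>\<open>pow2 V\<close> is the numerator of the far weight: the list of facilities has one
  entry less than there are vertices and is itself the counter for the exponent.\<close>

definition reduce_build :: "val \<Rightarrow> val \<Rightarrow> val \<Rightarrow> val \<Rightarrow> val \<Rightarrow> val \<Rightarrow> val" where
  "reduce_build \<kappa> X M V J \<phi> =
     Node (pow2 \<kappa>) (Node (pow2 M)
       (Node (vfold edge_step (Node (Node (Node Leaf (pow2 V)) (enc_int 1)) (Node V Leaf)))
         (Node (enc_list enc_nat [0]) (Node V
           (vfold clause_group_step (Node (Node (Node \<kappa> X) (Node V (pow2 \<kappa>)))
             (Node \<phi> (vfold block_group_step (Node (Node \<kappa> V) (Node J Leaf))))))))))"

definition reduce :: "val \<Rightarrow> val" where
  "reduce x = (\<lambda>y. reduce_build (left y) (left (right y)) (left (right (right y)))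
     (left (right (right (right y)))) (left (right (right (right (right y)))))
     (right (right (right (right (right y)))))) (reduce_expand x)"

lemma vars_val_enc:
  "vars_val (Node \<kappa> (Node (enc_nat N) z)) = enc_list enc_nat (vars (length (vlist \<kappa>)) N)"
  by (simp add: vars_val_def vars_def enum_eq length_vlist_drop_bits)

lemma length_vlist_num_bits_val:
  "length (vlist (num_bits_val (Node \<kappa> (Node (enc_nat N) z)))) = num_bits (length (vlist \<kappa>)) N"
  by (simp add: num_bits_val_def vars_val_enc num_bits_def length_vlist_append_val)

lemma enc_rat_of_nat: "enc_rat (of_nat D) = Node (Node Leaf (enc_nat D)) (enc_int 1)"
proof -
  have "quotient_of (of_nat D) = (int D, 1)"
    using quotient_of_int[of "int D"] by (simp add: of_int_def[symmetric])
  then show ?thesis by (simp add: enc_rat_def enc_prod_def enc_int_def enc_bool_def)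
qed

lemma enc_cnf_eq: "enc_cnf (N, \<phi>) = Node (enc_nat N) (enc_list (enc_list enc_literal) \<phi>)"
  by (simp add: enc_cnf_def enc_prod_def)

lemma reduce_enc:
  "reduce (Node \<kappa> (enc_cnf (N, \<phi>))) = enc_instance (reduct (length (vlist \<kappa>)) N \<phi>)"
proof -
  let ?K = "length (vlist \<kappa>)"
  have V: "enum (num_bits_val (Node \<kappa> (Node (enc_nat N) z))) = enc_list enc_nat (nats (num_bits ?K N))" for z
    by (simp add: enum_eq length_vlist_num_bits_val)
  have J: "Node Leaf (enum \<kappa>) = enc_list enc_nat (0 # nats ?K)"
    by (simp add: enum_eq)
  have D: "Node (Node Leaf (enc_nat (2 ^ (2 ^ num_bits ?K N - 1)))) (enc_int 1) =
      enc_rat (2 ^ (2 ^ num_bits ?K N - 1))"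
    using enc_rat_of_nat[of "2 ^ (2 ^ num_bits ?K N - 1)"] by simp
  show ?thesis
    unfolding reduce_def reduce_expand_def left.simps right.simps enc_cnf_eq vars_val_enc V J
    unfolding reduce_build_def pow2_eq vlist_enc_list length_map length_nats D edges_enc block_groups_enc clause_groups_enc length_vlist_num_bits_val
    by (simp add: enc_instance_def reduct_def)
qed

text \<open>The three powers bound the three enumerations: of blocks, of positions inside a block,
  and of facilities.\<close>

definition reduce_measure :: "val \<Rightarrow> nat" where
  "reduce_measure x = size x + (2 ^ length (vlist (left x)) +
     (2 ^ length (vlist (left (right x))) + 2 ^ length (vlist (num_bits_val x))))"

lemma polytime_reduce: "polytime reduce_measure reduce"
proof -
  have s: "poly_bounded reduce_measure size"
    by (rule poly_bounded_mono[OF poly_bounded_self]) (simp add: reduce_measure_def)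
  have e: "polytime reduce_measure (\<lambda>x. enum (f x))"
    if "polytime reduce_measure f" "\<And>x. 2 ^ length (vlist (f x)) \<le> reduce_measure x" for f
    by (rule polytime_comp_gen[OF polytime_enum that(1) poly_bounded_add[OF polytime_size[OF that(1)] poly_bounded_mono[OF poly_bounded_self that(2)]]])
  have "2 ^ length (vlist (drop_bits (left x) (left (right x)))) \<le> reduce_measure x" for x
    using power_increasing[of "length (vlist (drop_bits (left x) (left (right x))))"
        "length (vlist (left (right x)))" "2 :: nat"]
    unfolding reduce_measure_def length_vlist_drop_bits by linarith
  then have X: "polytime reduce_measure vars_val"
    unfolding vars_val_def[abs_def] by (intro e polytime_drop_bits polytime_intros s)
  then have M: "polytime reduce_measure num_bits_val"
    unfolding num_bits_val_def[abs_def] by (intro polytime_append_val polytime_intros s)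
  have V: "polytime reduce_measure (\<lambda>x. enum (num_bits_val x))"
    by (rule e[OF M]) (simp add: reduce_measure_def)
  have J: "polytime reduce_measure (\<lambda>x. enum (left x))"
    by (rule e[OF polytime_left[OF polytime_id[OF s]]]) (simp add: reduce_measure_def)
  have "polytime reduce_measure reduce_expand"
    unfolding reduce_expand_def[abs_def] by (intro X M V J polytime_intros s)
  moreover have "polytime size (\<lambda>y. reduce_build (left y) (left (right y)) (left (right (right y)))
     (left (right (right (right y)))) (left (right (right (right (right y)))))
     (right (right (right (right (right y))))))"
    unfolding reduce_build_def
    by (intro polytime_Node polytime_const polytime_pow2 polytime_comp[OF polytime_edges] polytime_comp[OF polytime_clause_groups]
        polytime_comp[OF polytime_block_groups] polytime_left polytime_right polytime_id poly_bounded_self)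
  ultimately show ?thesis
    unfolding reduce_def[abs_def] by (rule polytime_comp[rotated])
qed

section \<open>Sizes of encodings\<close>

lemma size_enc_nat: "size (enc_nat n) \<le> 2 * n"
proof (induction n rule: less_induct)
  case (less n)
  show ?case
  proof (cases "n = 0")
    case False
    then have "size (enc_nat (n div 2)) \<le> 2 * (n div 2)" using less by simp
    moreover have "size (enc_nat n) \<le> size (enc_nat (n div 2)) + 2"
      using False by (subst enc_nat.simps) (simp add: enc_bool_def)
    ultimately show ?thesis using False by (cases "n = 1") (auto simp: enc_bool_def)
  qed simp
qed

lemma size_enc_list:
  assumes "\<And>x. x \<in> set xs \<Longrightarrow> size (e x) \<le> B"
  shows "size (enc_list e xs) \<le> length xs * (B + 1)"
  using assms
proof (induction xs)
  case (Cons x xs)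
  then have "size (e x) \<le> B" "size (enc_list e xs) \<le> length xs * (B + 1)" by auto
  then show ?case by simp
qed simp

lemma size_enc_cnf:
  assumes "is_3cnf N \<phi>"
  shows "size (enc_cnf (N, \<phi>)) \<le> 2 * N + 1 + length \<phi> * (6 * N + 10)"
proof -
  have "size (enc_list (enc_list enc_literal) \<phi>) \<le> length \<phi> * (3 * (2 * N + 2 + 1) + 1)"
  proof (rule size_enc_list)
    fix C assume C: "C \<in> set \<phi>"
    have "size (enc_list enc_literal C) \<le> length C * (2 * N + 2 + 1)"
    proof (rule size_enc_list)
      fix l assume "l \<in> set C"
      with assms C have "case l of (x, b) \<Rightarrow> x < N" unfolding is_3cnf_def by blast
      then have "fst l < N" by (cases l) simp
      then show "size (enc_literal l) \<le> 2 * N + 2"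
        using size_enc_nat[of "fst l"] by (simp add: enc_prod_def enc_bool_def)
    qed
    also have "\<dots> \<le> 3 * (2 * N + 2 + 1)"
      using assms C by (intro mult_right_mono) (auto simp: is_3cnf_def)
    finally show "size (enc_list enc_literal C) \<le> 3 * (2 * N + 2 + 1)" .
  qed
  then show ?thesis
    using size_enc_nat[of N] by (simp add: enc_cnf_eq algebra_simps)
qed

section \<open>Star metrics\<close>

definition star :: "fr_instance \<Rightarrow> bool" where
  "star I \<longleftrightarrow> 2 \<le> num_verts I \<and> fst ` set (edges I) = Pair 0 ` {1..<num_verts I} \<and>
     distinct (map fst (edges I)) \<and> (\<forall>(e, w) \<in> set (edges I). 0 < w)"

lemma star_verts [simp]: "verts (graph_of I) = {..<num_verts I}"
  and star_tail [simp]: "tail (graph_of I) = fst"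
  and star_head [simp]: "head (graph_of I) = snd"
  by (simp_all add: graph_of_def)

lemma star_arcs:
  assumes "star I"
  shows "arcs (graph_of I) = {(u, v). (u = 0 \<and> v \<in> {1..<num_verts I}) \<or> (v = 0 \<and> u \<in> {1..<num_verts I})}"
  using assms by (auto simp: graph_of_def star_def image_image image_iff)

lemma star_wf_digraph: "star I \<Longrightarrow> wf_digraph (graph_of I)"
  by unfold_locales (auto simp: star_arcs star_def)

lemma star_connected:
  assumes "star I"
  shows "Digraph_Component.connected (graph_of I)"
proof -
  let ?G = "graph_of I"
  interpret wf_digraph ?G using assms by (rule star_wf_digraph)
  have n: "2 \<le> num_verts I" using assms by (simp add: star_def)
  have "0 \<rightarrow>\<^sup>*\<^bsub>?G\<^esub> v \<and> v \<rightarrow>\<^sup>*\<^bsub>?G\<^esub> 0" if "v < num_verts I" for v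
  proof (cases "v = 0")
    case True
    then show ?thesis using n by simp
  next
    case False
    with that have "(0, v) \<in> arcs_ends ?G" "(v, 0) \<in> arcs_ends ?G"
      by (auto simp: arcs_ends_conv star_arcs[OF assms] image_iff)
    then show ?thesis by auto
  qed
  then have "u \<rightarrow>\<^sup>*\<^bsub>?G\<^esub> v" if "u < num_verts I" "v < num_verts I" for u v
    using that reachable_trans by blast
  then show ?thesis
    unfolding connected_def strongly_connected_def using n
    by (auto intro!: reachable_mk_symmetricI simp: lessThan_empty_iff)
qed

text \<open>Every other vertex of a walk in a star is the centre. A closed walk with at least 3 arcs
  therefore meets the centre twice in the tail of its vertex list, which a cycle forbids.\<close>

lemma star_tree_metric:
  assumes "star I"
  shows "tree_metric I"
proof -
  interpret wf_digraph "graph_of I" using assms by (rule star_wf_digraph)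
  note arcs = star_arcs[OF assms]
  have False if c: "cycle p" and l: "3 \<le> length p" for p
  proof -
    from c obtain u where w: "awalk u p u" and d: "distinct (tl (awalk_verts u p))"
      unfolding cycle_def by blast
    from l obtain e1 e2 e3 q where p: "p = e1 # e2 # e3 # q"
      by (metis Suc_le_length_iff numeral_3_eq_3)
    from w have cas: "fst e1 = u" "fst e2 = snd e1" "fst e3 = snd e2" "cas (snd e3) q u"
      and in_arcs: "{e1, e2, e3} \<union> set q \<subseteq> arcs (graph_of I)"
      by (auto simp: awalk_def p)
    show False
    proof (cases "u = 0")
      case False
      with cas in_arcs have "snd e1 = 0" "fst e2 = 0" "snd e2 \<noteq> 0" "fst e3 \<noteq> 0" "snd e3 = 0"
        by (auto simp: arcs)
      with d cas show False by (cases q) (auto simp: p)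
    next
      case True
      with cas in_arcs have e: "snd e1 \<noteq> 0" "snd e2 = 0" "fst e3 = 0" "snd e3 \<noteq> 0"
        by (auto simp: arcs)
      \<comment> \<open>Three arcs starting at the centre end away from it, so a fourth one has to
        lead back.\<close>
      with cas(4) True obtain e4 r where q: "q = e4 # r" by (cases q) auto
      with cas(4) in_arcs e have "fst e4 = snd e3" "snd e4 = 0" by (auto simp: arcs)
      with d e q show False by (cases r) (use cas(4) in \<open>auto simp: p\<close>)
    qed
  qed
  then show ?thesis using star_connected[OF assms] unfolding tree_metric_def by blast
qed

lemma star_weight:
  assumes "star I" "((0, v), w) \<in> set (edges I)"
  shows "weight I (0, v) = real_of_rat w" "weight I (v, 0) = real_of_rat w"
  using assms by (auto simp: star_def weight_def)

text \<open>\<open>v\<close> is a leaf, so the last arc of any walk from the centre to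
  \<open>v\<close> is \<open>(0, v)\<close>, and the arcs before it cost at least 0.\<close>

lemma star_sp_dist:
  assumes "star I" "((0, v), w) \<in> set (edges I)"
  shows "sp_dist I 0 v = ereal (real_of_rat w)"
proof -
  interpret wf_digraph "graph_of I" using assms(1) by (rule star_wf_digraph)
  note arcs = star_arcs[OF assms(1)]
  have "(0, v) \<in> fst ` set (edges I)" using assms(2) by force
  then have v: "1 \<le> v" "v < num_verts I" using assms(1) by (auto simp: star_def)
  have nonneg: "0 \<le> weight I e" if "e \<in> arcs (graph_of I)" for e
  proof -
    from that obtain y where y: "y \<in> {1..<num_verts I}" "e = (0, y) \<or> e = (y, 0)"
      by (cases e) (auto simp: arcs)
    then have "(0, y) \<in> fst ` set (edges I)" using assms(1) by (auto simp: star_def)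
    then obtain w' where "((0, y), w') \<in> set (edges I)" by auto
    with star_weight[OF assms(1) this] y(2) assms(1) show ?thesis
      by (fastforce simp: star_def zero_le_of_rat_iff)
  qed
  have "sp_dist I 0 v = ereal (weight I (0, v))"
    unfolding sp_dist_def \<mu>_def
  proof (rule antisym)
    have "awalk 0 [(0, v)] v" using v by (auto simp: awalk_def arcs)
    then show "(INF p \<in> {p. awalk 0 p v}. ereal (awalk_cost (weight I) p)) \<le> ereal (weight I (0, v))"
      by (intro INF_lower2[of "[(0, v)]"]) (auto simp: awalk_cost_def)
    show "ereal (weight I (0, v)) \<le> (INF p \<in> {p. awalk 0 p v}. ereal (awalk_cost (weight I) p))"
    proof (rule INF_greatest)
      fix p assume "p \<in> {p. awalk 0 p v}"
      then have p: "awalk 0 p v" by simp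
      with v have "p \<noteq> []" by (auto simp: awalk_def)
      then obtain q e where q: "p = q @ [e]" by (metis rev_exhaust)
      with p have "awalk 0 q (fst e)" "snd e = v" "e \<in> arcs (graph_of I)"
        by (auto simp: awalk_simps awalk_def)
      moreover from this v have "e = (0, v)" by (auto simp: arcs)
      moreover have "0 \<le> awalk_cost (weight I) q"
        using pos_cost_pos_awalk_cost[OF \<open>awalk 0 q (fst e)\<close>] nonneg by blast
      ultimately show "ereal (weight I (0, v)) \<le> ereal (awalk_cost (weight I) p)"
        by (simp add: q)
    qed
  qed
  then show ?thesis using star_weight[OF assms] by simp
qed

section \<open>Correctness of the reduction\<close>

lemma set_vars: "set (vars K N) = {..<2 ^ (length (vlist (enc_nat N)) - K)}"
  by (auto simp: vars_def set_nats)

lemma distinct_vars: "distinct (vars K N)"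
  by (auto simp: vars_def set_nats distinct_nats)

lemma length_vars: "length (vars K N) = 2 ^ (length (vlist (enc_nat N)) - K)"
  using distinct_card[OF distinct_vars, of K N] by (simp add: set_vars)

lemma var_index:
  assumes "x < N"
  obtains i where "i < length (vars K N)" "vars K N ! i = x div 2 ^ K"
proof -
  let ?l = "length (vlist (enc_nat N))"
  have x: "x < 2 ^ ?l" using assms less_two_power_length_enc_nat[of N] by linarith
  have "x div 2 ^ K < 2 ^ (?l - K)"
  proof (cases "K \<le> ?l")
    case True
    then have "(2 :: nat) ^ ?l = 2 ^ (?l - K) * 2 ^ K" by (simp flip: power_add)
    with x show ?thesis by (intro less_mult_imp_div_less) simp
  next
    case False
    \<comment> \<open>There are more blocks than \<open>N\<close> requires: every position is then
      0, the only entry of \<open>vars\<close>.\<close>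
    then have "(2 :: nat) ^ ?l \<le> 2 ^ K" by (intro power_increasing) auto
    with x have "x div 2 ^ K = 0" by (intro div_less) linarith
    then show ?thesis by simp
  qed
  then have "x div 2 ^ K \<in> set (vars K N)" by (simp add: set_vars)
  then show ?thesis using that by (metis in_set_conv_nth)
qed

lemma sat_literal_iff:
  assumes "i < length (vars K N)" "vars K N ! i = x div 2 ^ K"
  shows "sat_literal K (vars K N) v (x, b) \<longleftrightarrow>
    v mod 2 ^ K = x mod 2 ^ K \<and> bit (v div 2 ^ K) i = b"
  using lookup_bit_nth[OF distinct_vars assms(1)] by (simp add: sat_literal_def assms(2))

definition cnf_sat :: "cnf \<Rightarrow> bool" where
  "cnf_sat \<phi> \<longleftrightarrow> (\<exists>a. \<forall>C \<in> set \<phi>. sat_clause a C)"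

lemma num_bits_ge_2: "2 \<le> num_bits K N"
  by (simp add: num_bits_def vars_def)

lemma reduct_groups:
  "set (groups (reduct K N \<phi>)) =
     (\<lambda>C. (clause_group K (vars K N) C (nats (num_bits K N)), 1, int (2 ^ K))) ` set \<phi> \<union>
     (\<lambda>j. (block_group K j (nats (num_bits K N)), 0, 1)) ` {..<2 ^ K}"
proof -
  have "set (0 # nats K) = {..<2 ^ K}" by (auto simp: set_nats)
  then show ?thesis by (simp only: reduct_def fr_instance.simps set_append set_rev set_map)
qed

lemma set_block_group: "set (block_group K j (nats m)) =
    {v. 1 \<le> v \<and> v < 2 ^ m \<and> (v = 1 \<or> v mod 2 ^ K = j mod 2 ^ K)}"
  by (auto simp: block_group_def set_nats)

lemma set_clause_group: "set (clause_group K xs C (nats m)) =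
    {v. 1 \<le> v \<and> v < 2 ^ m \<and> (v = 1 \<or> (\<exists>l \<in> set C. sat_literal K xs v l))}"
  by (auto simp: clause_group_def set_nats)

text \<open>Since the upper bound of a clause group equals the budget, its range becomes
  non-emptiness.\<close>

lemma reduct_feasible_iff:
  "fr_feasible (reduct K N \<phi>) S \<longleftrightarrow> S \<subseteq> {1..<2 ^ num_bits K N} \<and> card S \<le> 2 ^ K \<and>
     (\<forall>C \<in> set \<phi>. S \<inter> set (clause_group K (vars K N) C (nats (num_bits K N))) \<noteq> {}) \<and>
     (\<forall>j < 2 ^ K. card (S \<inter> set (block_group K j (nats (num_bits K N)))) \<le> 1)"
proof (cases "S \<subseteq> {1..<2 ^ num_bits K N} \<and> card S \<le> 2 ^ K")
  case True
  then have fin: "finite S" using finite_subset by blast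
  have "1 \<le> int (card (S \<inter> G)) \<and> int (card (S \<inter> G)) \<le> int (2 ^ K) \<longleftrightarrow> S \<inter> G \<noteq> {}" for G
  proof -
    have "card (S \<inter> G) \<le> 2 ^ K" using True card_mono[OF fin, of "S \<inter> G"] by simp
    moreover have "card (S \<inter> G) = 0 \<longleftrightarrow> S \<inter> G = {}" using fin by simp
    ultimately show ?thesis by linarith
  qed
  with True show ?thesis
    unfolding fr_feasible_def reduct_groups by (simp add: reduct_def set_nats ball_Un, simp add: Ball_def)
next
  case False
  then show ?thesis by (auto simp: fr_feasible_def reduct_def set_nats)
qed

text \<open>From every block choose the facility that stores the restriction of a satisfying
  assignment. A true literal of a clause puts the facility of its block into the group of that
  clause.\<close>

lemma reduct_complete:
  assumes "is_3cnf N \<phi>" "cnf_sat \<phi>"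
  shows "\<exists>S. fr_feasible (reduct K N \<phi>) S \<and> S \<noteq> {} \<and> 1 \<notin> S"
proof -
  let ?k = "2 ^ K :: nat" and ?xs = "vars K N"
  let ?p = "length ?xs"
  from assms(2) obtain a where a: "\<And>C. C \<in> set \<phi> \<Longrightarrow> sat_clause a C"
    unfolding cnf_sat_def by blast
  \<comment> \<open>The trailing \<open>True\<close> is the spare top bit. As a block has at least
    one position, it forces \<open>2 \<le> w j\<close>, which keeps \<open>v j\<close> apart from
    1.\<close>
  define bs where "bs j = map (\<lambda>y. a (j + ?k * y)) ?xs @ [True]" for j
  define w where "w j = (horner_sum of_bool 2 (bs j) :: nat)" for j
  define v where "v j = j + ?k * w j" for j
  have bit_w: "bit (w j) i \<longleftrightarrow> i < Suc ?p \<and> bs j ! i" for i j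
    by (simp add: w_def bit_horner_sum_bit_iff bs_def)
  have w_less: "w j < 2 ^ Suc ?p" for j
  proof -
    have "take_bit (Suc ?p) (w j) = w j"
      by (rule bit_eqI) (auto simp: bit_take_bit_iff bit_w)
    then show ?thesis by (metis take_bit_nat_less_exp)
  qed
  have p: "1 \<le> ?p" by (simp add: vars_def)
  have w_ge: "2 \<le> w j" for j
  proof (rule ccontr)
    assume "\<not> 2 \<le> w j"
    then have "w j = 0 \<or> w j = 1" by linarith
    moreover have "bit (w j) ?p" by (simp add: bit_w bs_def nth_append)
    ultimately show False using p by (auto simp: bit_Suc_0_iff)
  qed
  have v_div: "v j div ?k = w j" and v_mod: "v j mod ?k = j" if "j < ?k" for j
    using that by (simp_all add: v_def)
  have v_ge: "2 \<le> v j" for j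
    using mult_le_mono[of 1 ?k 2 "w j"] w_ge[of j] by (simp add: v_def)
  have v_less: "v j < 2 ^ num_bits K N" if "j < ?k" for j
  proof -
    have "v j < ?k * Suc (w j)" using that by (simp add: v_def)
    also have "\<dots> \<le> ?k * 2 ^ Suc ?p" using w_less[of j] by (intro mult_le_mono2) simp
    also have "\<dots> = 2 ^ num_bits K N" by (simp add: num_bits_def power_add)
    finally show ?thesis .
  qed
  let ?S = "v ` {..<?k}"
  have "fr_feasible (reduct K N \<phi>) ?S"
    unfolding reduct_feasible_iff
  proof (intro conjI ballI allI impI)
    show "?S \<subseteq> {1..<2 ^ num_bits K N}"
    proof
      fix u assume "u \<in> ?S"
      then obtain j where "j < ?k" "u = v j" by auto
      with v_less[of j] v_ge[of j] show "u \<in> {1..<2 ^ num_bits K N}" by simp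
    qed
    show "card ?S \<le> 2 ^ K" using card_image_le[of "{..<?k}" v] by simp
  next
    fix C assume C: "C \<in> set \<phi>"
    with a obtain x b where xb: "(x, b) \<in> set C" "a x = b" by (fastforce simp: sat_clause_def)
    with C assms(1) have "x < N" by (fastforce simp: is_3cnf_def)
    then obtain i where i: "i < ?p" "?xs ! i = x div ?k" by (rule var_index)
    let ?j = "x mod ?k"
    have j: "?j < ?k" by simp
    have "bit (w ?j) i = a (?j + ?k * (x div ?k))"
      using i by (simp add: bit_w bs_def nth_append)
    also have "?j + ?k * (x div ?k) = x" by simp
    finally have "sat_literal K ?xs (v ?j) (x, b)"
      using sat_literal_iff[OF i] v_div[OF j] v_mod[OF j] xb by simp
    then have "v ?j \<in> ?S \<inter> set (clause_group K ?xs C (nats (num_bits K N)))"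
      using j v_less[OF j] v_ge[of ?j] xb unfolding set_clause_group by fastforce
    then show "?S \<inter> set (clause_group K ?xs C (nats (num_bits K N))) \<noteq> {}" by blast
  next
    fix j assume j: "j < ?k"
    have "?S \<inter> set (block_group K j (nats (num_bits K N))) \<subseteq> {v j}"
    proof
      fix u assume u: "u \<in> ?S \<inter> set (block_group K j (nats (num_bits K N)))"
      then obtain j' where j': "j' < ?k" "u = v j'" by auto
      with u v_ge[of j'] have "v j' mod ?k = j mod ?k" unfolding set_block_group by auto
      with j j' v_mod show "u \<in> {v j}" by simp
    qed
    then show "card (?S \<inter> set (block_group K j (nats (num_bits K N)))) \<le> 1"
      using card_mono[of "{v j}"] by fastforce
  qed
  moreover have "?S \<noteq> {}" by (simp add: lessThan_empty_iff)
  moreover have "1 \<notin> ?S" 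
  proof
    assume "1 \<in> ?S"
    then obtain j where "1 = v j" by blast
    with v_ge[of j] show False by simp
  qed
  ultimately show ?thesis by blast
qed

text \<open>Facility 1 belongs to every block group and every other facility to the group of its
  residue. So choosing 1 excludes all others, and at most one facility per block is chosen.\<close>

lemma reduct_block_unique:
  assumes "fr_feasible (reduct K N \<phi>) S" "u \<in> S" "v \<in> S"
    and "u = 1 \<or> u mod 2 ^ K = v mod 2 ^ K"
  shows "u = v"
proof -
  let ?j = "v mod 2 ^ K"
  let ?B = "S \<inter> set (block_group K ?j (nats (num_bits K N)))"
  have S: "S \<subseteq> {1..<2 ^ num_bits K N}" and "card ?B \<le> 1"
    using assms(1) by (auto simp: reduct_feasible_iff)
  then have "finite ?B" using finite_subset by blast
  moreover have "u \<in> ?B" "v \<in> ?B" using S assms by (auto simp: set_block_group)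
  ultimately show ?thesis using \<open>card ?B \<le> 1\<close> card_le_Suc0_iff_eq[of ?B] by simp
qed

lemma reduct_sound:
  assumes "is_3cnf N \<phi>" "fr_feasible (reduct K N \<phi>) S" "1 \<notin> S"
  shows "cnf_sat \<phi>"
proof -
  let ?k = "2 ^ K :: nat" and ?xs = "vars K N"
  \<comment> \<open>Variables of a block without a chosen facility become false.\<close>
  define a where "a x \<longleftrightarrow> (\<exists>v \<in> S. sat_literal K ?xs v (x, True))" for x
  have "sat_clause a C" if C: "C \<in> set \<phi>" for C
  proof -
    from C assms(2) obtain v where v: "v \<in> S" "v \<in> set (clause_group K ?xs C (nats (num_bits K N)))"
      unfolding reduct_feasible_iff by blast
    with assms(3) obtain x b where xb: "(x, b) \<in> set C" "sat_literal K ?xs v (x, b)"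
      unfolding set_clause_group by fastforce
    with C assms(1) have "x < N" by (fastforce simp: is_3cnf_def)
    then obtain i where i: "i < length ?xs" "?xs ! i = x div ?k" by (rule var_index)
    note sat = sat_literal_iff[OF i]
    have "a x = b"
    proof (cases b)
      case True
      with v xb show ?thesis by (auto simp: a_def)
    next
      case False
      \<comment> \<open>Consistency: a chosen facility that makes \<open>x\<close> true lies in the
        same block as \<open>v\<close>, hence is \<open>v\<close>, which stores false for
        \<open>x\<close>.\<close>
      have "\<not> sat_literal K ?xs v' (x, True)" if v': "v' \<in> S" for v'
      proof
        assume "sat_literal K ?xs v' (x, True)"
        with sat xb have "v' mod ?k = v mod ?k" "bit (v' div ?k) i" by auto
        moreover from this have "v' = v" using reduct_block_unique[OF assms(2) v' v(1)] by blast
        ultimately show False using sat xb False by simp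
      qed
      with False show ?thesis by (simp add: a_def)
    qed
    with xb(1) show ?thesis unfolding sat_clause_def by (intro bexI[of _ "(x, b)"]) auto
  qed
  then show ?thesis unfolding cnf_sat_def by blast
qed

section \<open>Costs of the reduced instance\<close>

lemma reduct_star: "star (reduct K N \<phi>)"
proof -
  let ?m = "num_bits K N"
  have "(2 :: nat) \<le> 2 ^ ?m"
    using power_increasing[of 1 ?m "2 :: nat"] num_bits_ge_2[of K N] by simp
  moreover have "inj_on (Pair (0 :: nat)) A" for A :: "nat set" by (auto simp: inj_on_def)
  ultimately show ?thesis
    by (auto simp: star_def reduct_def image_image set_nats distinct_map distinct_nats
        rev_map[symmetric] comp_def inj_on_def)
qed

lemma reduct_sp_dist:
  assumes "v \<in> {1..<2 ^ num_bits K N}"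
  shows "sp_dist (reduct K N \<phi>) 0 v = ereal (if v = 1 then 2 ^ (2 ^ num_bits K N - 1) else 1)"
proof -
  have "((0, v), if v \<le> 1 then 2 ^ (2 ^ num_bits K N - 1) else 1) \<in> set (edges (reduct K N \<phi>))"
    using assms by (auto simp: reduct_def set_nats image_iff)
  from star_sp_dist[OF reduct_star this] show ?thesis
    using assms by (auto simp: of_rat_power)
qed

text \<open>With a single client the two costs are a distance and its square; the distance is at
  least 1, so lower bounds carry over to the square. \<open>S \<subseteq> {1}\<close> includes the
  empty set, at distance infinity.\<close>

lemma reduct_cost:
  assumes "cost \<in> {med_cost, means_cost}" "S \<subseteq> {1..<2 ^ num_bits K N}"
  shows "1 \<le> cost (reduct K N \<phi>) S"
    and "1 \<notin> S \<Longrightarrow> S \<noteq> {} \<Longrightarrow> cost (reduct K N \<phi>) S = 1"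
    and "S \<subseteq> {1} \<Longrightarrow> ereal (2 ^ (2 ^ num_bits K N - 1)) \<le> cost (reduct K N \<phi>) S"
proof -
  let ?I = "reduct K N \<phi>" and ?D = "2 ^ (2 ^ num_bits K N - 1) :: real"
  have cost: "cost ?I S = set_dist ?I 0 S \<or> cost ?I S = (set_dist ?I 0 S)\<^sup>2"
    using assms(1) by (auto simp: med_cost_def means_cost_def reduct_def)
  have pow: "x \<le> x\<^sup>2" if "1 \<le> x" for x :: ereal
    using that ereal_mult_left_mono[of 1 x x] by (simp add: power2_eq_square order_trans[of 0 1])
  have D: "1 \<le> ?D" by simp
  have d: "set_dist ?I 0 S = (INF s \<in> S. ereal (if s = 1 then ?D else 1))"
    unfolding set_dist_def using assms(2) by (intro INF_cong reduct_sp_dist refl) auto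
  have ge1: "1 \<le> set_dist ?I 0 S" unfolding d by (rule INF_greatest) auto
  with pow show "1 \<le> cost ?I S" using cost order_trans by metis
  show "cost ?I S = 1" if "1 \<notin> S" "S \<noteq> {}"
  proof -
    have "set_dist ?I 0 S = (INF s \<in> S. 1)" unfolding d using that(1) by (intro INF_cong) auto
    with that(2) have "set_dist ?I 0 S = 1" by simp
    with cost show ?thesis by auto
  qed
  show "ereal ?D \<le> cost ?I S" if "S \<subseteq> {1}"
  proof -
    have "ereal ?D \<le> set_dist ?I 0 S" unfolding d by (rule INF_greatest) (use that in auto)
    with pow[OF ge1] show ?thesis using cost order_trans by metis
  qed
qed

text \<open>If the formula is satisfiable, the optimum is 1 and the approximation cannot afford the
  far facility. If not, soundness forces 1 into \<open>S\<close>, which then excludes everything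
  else.\<close>

lemma reduct_decides:
  assumes cost: "cost \<in> {med_cost, means_cost}" and \<phi>: "is_3cnf N \<phi>"
    and S: "fr_feasible (reduct K N \<phi>) S"
    and \<rho>: "cost (reduct K N \<phi>) S \<le> ereal \<rho> * opt_cost cost (reduct K N \<phi>)"
      "\<rho> < 2 ^ (2 ^ num_bits K N - 1)"
  shows "if cnf_sat \<phi> then 1 \<notin> S \<and> S \<noteq> {} else S = {1}"
proof (cases "cnf_sat \<phi>")
  case True
  let ?I = "reduct K N \<phi>"
  have sub: "S' \<subseteq> {1..<2 ^ num_bits K N}" if "fr_feasible ?I S'" for S'
    using that by (simp add: reduct_feasible_iff)
  from reduct_complete[OF \<phi> True] obtain S0 where
    S0: "fr_feasible ?I S0" "S0 \<noteq> {}" "1 \<notin> S0" by blast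
  have "opt_cost cost ?I = 1"
    unfolding opt_cost_def
  proof (rule antisym)
    show "(INF S \<in> {S. fr_feasible ?I S}. cost ?I S) \<le> 1"
      using S0 reduct_cost(2)[OF cost sub] by (intro INF_lower2[of S0]) auto
    show "1 \<le> (INF S \<in> {S. fr_feasible ?I S}. cost ?I S)"
      using reduct_cost(1)[OF cost sub] by (intro INF_greatest) auto
  qed
  with \<rho>(1) have "cost ?I S \<le> ereal \<rho>" by simp
  also have "\<dots> < ereal (2 ^ (2 ^ num_bits K N - 1))" using \<rho>(2) by simp
  finally have "\<not> S \<subseteq> {1}" using reduct_cost(3)[OF cost sub[OF S], of \<phi>] by (meson leD)
  then obtain v where "v \<in> S" "v \<noteq> 1" by blast
  with reduct_block_unique[OF S, of 1 v] True show ?thesis by auto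
next
  case False
  with reduct_sound[OF \<phi> S] have "1 \<in> S" by blast
  have "v = 1" if "v \<in> S" for v
    using reduct_block_unique[OF S \<open>1 \<in> S\<close> that] by simp
  with \<open>1 \<in> S\<close> have "S = {1}" by blast
  with False show ?thesis by simp
qed

section \<open>The family of instances\<close>

text \<open>The bounds and the membership of \<open>1\<close> in all groups make \<open>{1}\<close> feasible.\<close>

definition star_family :: "real \<Rightarrow> fr_instance set" where
  "star_family b = {I. star I \<and> 0 < budget I \<and> budget I \<le> num_verts I \<and> clients I = [0] \<and>
     distinct (facilities I) \<and> set (facilities I) = {1..<num_verts I} \<and> groups I \<noteq> [] \<and>
     (\<forall>(G, \<alpha>, \<beta>) \<in> set (groups I). distinct G \<and> set G \<subseteq> {1..<num_verts I} \<and> 1 \<in> set G \<and>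
        0 \<le> \<alpha> \<and> \<alpha> \<le> 1 \<and> 1 \<le> \<beta> \<and> \<beta> \<le> int (num_verts I)) \<and>
     real (length (groups I)) \<le> b * real (budget I) ^ 3 * ln (real (num_verts I)) \<and>
     (\<forall>(e, w) \<in> set (edges I). size (enc_rat w) \<le> 2 * num_verts I + 10)}"

lemma star_family_instance:
  assumes "I \<in> star_family b"
  shows "is_fr_instance I"
proof -
  from assms have I: "star I" "0 < budget I" "2 \<le> num_verts I" "clients I = [0]"
    "distinct (facilities I)" "set (facilities I) = {1..<num_verts I}" "groups I \<noteq> []"
    and G: "\<forall>(G, \<alpha>, \<beta>) \<in> set (groups I). distinct G \<and> set G \<subseteq> {1..<num_verts I} \<and> 1 \<in> set G \<and>
        0 \<le> \<alpha> \<and> \<alpha> \<le> 1 \<and> 1 \<le> \<beta> \<and> \<beta> \<le> int (num_verts I)"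
    by (auto simp: star_family_def star_def)
  have "u < v \<and> v < num_verts I \<and> 0 < w" if "((u, v), w) \<in> set (edges I)" for u v w
  proof -
    from that have "(u, v) \<in> fst ` set (edges I)" by force
    with I(1) have "u = 0" "v \<in> {1..<num_verts I}" by (auto simp: star_def)
    with I(1) that show ?thesis by (fastforce simp: star_def)
  qed
  moreover have "distinct (map fst (edges I))" using I(1) by (simp add: star_def)
  ultimately show ?thesis
    using I G star_connected[OF I(1)] unfolding is_fr_instance_def by fastforce
qed

text \<open>The groups dominate: with budget and logarithm at most n, there are at most
  \<bar>b\<bar> n ^ 4 of them, each of size O(n ^ 2). The constants are generous.\<close>

lemma size_enc_instance:
  assumes "I \<in> star_family b"
  shows "real (size (enc_instance I)) \<le> (40 + 20 * \<bar>b\<bar>) * real (num_verts I) ^ 6"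
proof -
  define n where "n = num_verts I"
  from assms have I: "star I" "budget I \<le> n" "2 \<le> n" "clients I = [0]"
    "distinct (facilities I)" "set (facilities I) = {1..<n}"
    and G: "\<And>G \<alpha> \<beta>. (G, \<alpha>, \<beta>) \<in> set (groups I) \<Longrightarrow> distinct G \<and> set G \<subseteq> {1..<n} \<and> 1 \<in> set G \<and>
        0 \<le> \<alpha> \<and> \<alpha> \<le> 1 \<and> 1 \<le> \<beta> \<and> \<beta> \<le> int n"
    and L: "real (length (groups I)) \<le> b * real (budget I) ^ 3 * ln (real n)"
    and W: "\<And>e w. (e, w) \<in> set (edges I) \<Longrightarrow> size (enc_rat w) \<le> 2 * n + 10"
    unfolding star_family_def star_def n_def by fastforce+
  have nat: "size (enc_nat x) \<le> 2 * n" if "x \<le> n" for x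
    using size_enc_nat[of x] that by simp
  have "length (edges I) = card (set (map fst (edges I)))"
    using I(1) by (subst distinct_card) (auto simp: star_def)
  also have "\<dots> \<le> n"
    using I(1) card_image_le[of "{1..<n}" "Pair (0 :: nat)"] by (auto simp: star_def n_def)
  finally have le_n: "length (edges I) \<le> n" .
  have "size (enc_list enc_edge (edges I)) \<le> n * (4 * n + 15 + 1)"
  proof (rule order_trans[OF size_enc_list mult_right_mono[OF le_n]])
    fix x assume x: "x \<in> set (edges I)"
    obtain u v w where uvw: "x = ((u, v), w)" by (metis prod.exhaust)
    with x have "(u, v) \<in> fst ` set (edges I)" by force
    with I(1) have "u = 0" "v < n" by (auto simp: star_def n_def)
    with W[of "(u, v)" w] nat[of v] x uvw show "size (enc_edge x) \<le> 4 * n + 15"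
      by (simp add: enc_prod_def)
  qed auto
  moreover have nats: "size (enc_list enc_nat G) \<le> n * (2 * n + 1)"
    if "distinct G" "set G \<subseteq> {1..<n}" for G
  proof (rule order_trans[OF size_enc_list mult_right_mono])
    show "size (enc_nat x) \<le> 2 * n" if "x \<in> set G" for x
      using nat[of x] that \<open>set G \<subseteq> _\<close> by auto
    show "length G \<le> n"
      using card_mono[OF _ that(2)] distinct_card[OF that(1)] by simp
  qed auto
  moreover have "size (enc_list enc_group (groups I)) \<le>
      length (groups I) * (n * (2 * n + 1) + 4 * n + 6 + 1)"
  proof (rule size_enc_list)
    fix x assume x: "x \<in> set (groups I)"
    obtain G \<alpha> \<beta> where g: "x = (G, \<alpha>, \<beta>)" by (metis prod.exhaust)
    with x G[of G \<alpha> \<beta>] have g': "distinct G" "set G \<subseteq> {1..<n}" "0 \<le> \<alpha>" "\<alpha> \<le> 1" "0 \<le> \<beta>" "\<beta> \<le> int n"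
      by auto
    have int: "size (enc_int i) \<le> 2 * n + 2" if "0 \<le> i" "i \<le> int n" for i
    proof -
      have "nat i \<le> n" using that by linarith
      from nat[OF this] show ?thesis using that by (simp add: enc_int_def enc_bool_def)
    qed
    show "size (enc_group x) \<le> n * (2 * n + 1) + 4 * n + 6"
      using nats[OF g'(1,2)] int[of \<alpha>] int[of \<beta>] g' I(3) by (simp add: enc_prod_def g)
  qed
  moreover have "size (enc_list enc_nat (facilities I)) \<le> n * (2 * n + 1)"
    using I by (intro nats) auto
  moreover have size_eq: "size (enc_instance I) = size (enc_nat (budget I)) + size (enc_nat n) +
      size (enc_list enc_edge (edges I)) + 1 + size (enc_list enc_nat (facilities I)) +
      size (enc_list enc_group (groups I)) + 5"
    using I(4) by (simp add: enc_instance_def n_def)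
  ultimately have "size (enc_instance I) \<le> 2 * n + 2 * n + n * (4 * n + 16) + 1 + n * (2 * n + 1) +
      length (groups I) * (n * (2 * n + 1) + 4 * n + 6 + 1) + 5"
    using nat[OF I(2)] nat[of n] by (simp add: size_eq algebra_simps)
  then have "real (size (enc_instance I)) \<le> real (2 * n + 2 * n + n * (4 * n + 16) + 1 + n * (2 * n + 1) +
      length (groups I) * (n * (2 * n + 1) + 4 * n + 6 + 1) + 5)"
    by (rule of_nat_mono)
  also have "\<dots> = 4 * real n + real n * (4 * real n + 16) + 6 + real n * (2 * real n + 1) +
      real (length (groups I)) * (real n * (2 * real n + 1) + 4 * real n + 7)"
    by (simp add: algebra_simps)
  also have "\<dots> \<le> 40 * real n ^ 6 + (\<bar>b\<bar> * real n ^ 4) * (20 * real n ^ 2)"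
  proof (rule add_mono)
    have n1: "1 \<le> real n" using I(3) by simp
    have p: "real n ^ i \<le> real n ^ j" if "i \<le> j" for i j by (rule power_increasing[OF that n1])
    have q: "real n \<le> real n ^ 2" "1 \<le> real n ^ 2" using p[of 1 2] p[of 0 2] by simp_all
    from p[of 2 6] q
    show "4 * real n + real n * (4 * real n + 16) + 6 + real n * (2 * real n + 1) \<le> 40 * real n ^ 6"
      by (simp add: algebra_simps power2_eq_square)
    have "real (length (groups I)) \<le> \<bar>b\<bar> * real (budget I) ^ 3 * ln (real n)"
      by (rule order_trans[OF L]) (use n1 in \<open>intro mult_right_mono, auto\<close>)
    also have "\<dots> \<le> \<bar>b\<bar> * real n ^ 3 * real n"
      using n1 I(2) ln_bound[of "real n"] by (intro mult_mono power_mono mult_nonneg_nonneg) auto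
    also have "\<dots> = \<bar>b\<bar> * real n ^ 4" by (simp add: power_numeral_reduce)
    finally have "real (length (groups I)) \<le> \<bar>b\<bar> * real n ^ 4" .
    moreover have "real n * (2 * real n + 1) + 4 * real n + 7 \<le> 20 * real n ^ 2"
      using q by (simp add: algebra_simps power2_eq_square)
    ultimately show "real (length (groups I)) * (real n * (2 * real n + 1) + 4 * real n + 7) \<le>
        (\<bar>b\<bar> * real n ^ 4) * (20 * real n ^ 2)"
      by (intro mult_mono) auto
  qed
  also have "\<dots> = (40 + 20 * \<bar>b\<bar>) * real n ^ 6" by (simp add: algebra_simps flip: power_add)
  finally show ?thesis by (simp add: n_def)
qed

text \<open>The program that ignores its input and writes the list \<open>[1]\<close> finds a
  feasible solution in one step.\<close>

lemma fr_o_star_family: "fr_o_family (star_family b)"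
proof -
  let ?c = "Assign 0 (exp_of (enc_list enc_nat [1]))"
  have "\<exists>S. outputs_feasible ?c I 1 S" if I: "I \<in> star_family b" for I
  proof -
    have "run 1 (start ?c (enc_instance I)) =
        return_pmf ([], (\<lambda>_. Leaf)(0 := enc_list enc_nat [1]))"
      by (simp add: start_def bind_return_pmf)
    then have "computes_within ?c (enc_instance I) 1 (enc_list enc_nat [1])"
      unfolding computes_within_def
      by (intro conjI exI[of _ "(\<lambda>_. Leaf)(0 := enc_list enc_nat [1])"]) auto
    moreover have "{1} \<inter> set G = {1}" if "(G, \<alpha>, \<beta>) \<in> set (groups I)" for G \<alpha> \<beta>
      using I that by (fastforce simp: star_family_def)
    with I have "fr_feasible I {1}"
      by (fastforce simp: fr_feasible_def star_family_def star_def)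
    ultimately show ?thesis
      unfolding outputs_feasible_def by (intro exI[of _ "{1}"] conjI exI[of _ "[1 :: nat]"]) auto
  qed
  moreover have "real 1 \<le> poly 1 x" for x :: real by simp
  moreover have "real (size (enc_instance I)) \<le> poly (monom (40 + 20 * \<bar>b\<bar>) 6) (real (num_verts I))"
    if "I \<in> star_family b" for I
    using size_enc_instance[OF that] by (simp add: poly_monom)
  ultimately show ?thesis
    unfolding fr_o_family_def using star_family_instance by blast
qed

lemma star_family_tree_metric:
  assumes "I \<in> star_family b"
  shows "tree_metric I \<and> real (length (groups I)) \<le> b * real (budget I) ^ 3 * ln (real (num_verts I))"
  using assms by (auto simp: star_family_def intro: star_tree_metric)

section \<open>Membership of the reduced instances in the family\<close>

lemma size_enc_nat_two_power: "size (enc_nat (2 ^ j)) = j + 2"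
  by (induction j) simp_all

text \<open>For blocks of p positions, N \<le> k p, and the number of vertices is 2 ^ m with m > p.
  So clauses and blocks together are O(k log n), well within the cubic bound.\<close>

lemma reduct_star_family:
  assumes "real (length \<phi>) \<le> \<Delta> * real N" "0 < \<Delta>"
  shows "reduct K N \<phi> \<in> star_family (2 * (1 + \<Delta>))"
proof -
  let ?I = "reduct K N \<phi>" and ?m = "num_bits K N" and ?p = "length (vars K N)"
  have "(1 :: nat) < 2 ^ ?m" using num_bits_ge_2[of K N] by (intro one_less_power) auto
  then have one: "1 \<in> {1..<(2 :: nat) ^ ?m}" by simp
  have Km: "K \<le> ?m" by (simp add: num_bits_def)
  then have kn: "(2 :: nat) ^ K \<le> 2 ^ ?m" by (intro power_increasing) auto
  have groups: "distinct G \<and> set G \<subseteq> {1..<2 ^ ?m} \<and> 1 \<in> set G \<and>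
        0 \<le> \<alpha> \<and> \<alpha> \<le> 1 \<and> 1 \<le> \<beta> \<and> \<beta> \<le> int (2 ^ ?m)" if "(G, \<alpha>, \<beta>) \<in> set (groups ?I)" for G \<alpha> \<beta>
  proof -
    have "1 \<le> int (2 ^ K)" "int (2 ^ K) \<le> int (2 ^ ?m)" "1 \<le> int (2 ^ ?m)"
      using kn by (auto simp flip: of_nat_power)
    moreover have "distinct (block_group K j (nats ?m))"
      "distinct (clause_group K (vars K N) C (nats ?m))" for j C
      by (simp_all add: clause_group_def block_group_def distinct_nats)
    ultimately show ?thesis
      using that one unfolding reduct_groups by (auto simp: set_block_group set_clause_group)
  qed
  have rat: "size (enc_rat w) \<le> 2 * 2 ^ ?m + 10" if "(e, w) \<in> set (edges ?I)" for e w
  proof -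
    from that have "w = of_nat (2 ^ (2 ^ ?m - 1)) \<or> w = of_nat (2 ^ 0)"
      by (auto simp: reduct_def split: if_splits)
    then show ?thesis
      by (elim disjE) (simp_all only: enc_rat_of_nat val.size size_enc_nat_two_power,
          simp_all add: enc_int_def enc_bool_def)
  qed
  have "real (length (groups ?I)) \<le> 2 * (1 + \<Delta>) * real (2 ^ K) ^ 3 * ln (real (2 ^ ?m))"
  proof -
    let ?l = "length (vlist (enc_nat N))"
    have "N \<le> 2 ^ ?l" using less_two_power_length_enc_nat[of N] by simp
    also have "\<dots> \<le> 2 ^ (K + (?l - K))" by (intro power_increasing) auto
    also have "\<dots> = 2 ^ K * ?p" by (simp add: length_vars power_add)
    finally have "real N \<le> real (2 ^ K * ?p)" by (rule of_nat_mono)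
    then have "\<Delta> * real N \<le> \<Delta> * (2 ^ K * real ?p)"
      using assms(2) by (intro mult_left_mono) auto
    with assms(1) have "real (length \<phi>) \<le> \<Delta> * (2 ^ K * real ?p)" by linarith
    moreover have "real (length (groups ?I)) = real (length \<phi>) + 2 ^ K"
      using length_nats[of K] by (simp add: reduct_def of_nat_diff del: of_nat_Suc)
    ultimately have "real (length (groups ?I)) \<le> 2 ^ K * (1 + \<Delta> * real ?p)"
      by (simp add: algebra_simps)
    also have "\<dots> \<le> 2 ^ K * ((1 + \<Delta>) * real ?m)"
      using assms(2) by (intro mult_left_mono) (auto simp: num_bits_def algebra_simps)
    also have "\<dots> \<le> 2 ^ K * ((1 + \<Delta>) * (2 * ln (2 ^ ?m)))"
    proof (intro mult_left_mono)
      \<comment> \<open>The factor 2 in the bound on the groups comes from the estimate 1/2 \<le> ln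
        2.\<close>
      have "real ?m * (1 / 2) \<le> real ?m * ln 2"
        using ln2_ge_two_thirds by (intro mult_left_mono) auto
      then show "real ?m \<le> 2 * ln (2 ^ ?m)" by (simp add: ln_realpow)
    qed (use assms(2) in auto)
    also have "\<dots> = 2 * (1 + \<Delta>) * 2 ^ K * ln (2 ^ ?m)" by simp
    also have "\<dots> \<le> 2 * (1 + \<Delta>) * (2 ^ K) ^ 3 * ln (2 ^ ?m)"
      using assms(2) power_increasing[of 1 3 "2 ^ K :: real"]
      by (intro mult_right_mono mult_left_mono) auto
    finally show ?thesis by simp
  qed
  moreover have "budget ?I = 2 ^ K" "num_verts ?I = 2 ^ ?m" "clients ?I = [0]"
    "facilities ?I = nats ?m" "groups ?I \<noteq> []"
    by (simp_all add: reduct_def)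
  ultimately show ?thesis
    unfolding star_family_def using groups rat kn reduct_star[of K N \<phi>]
    by (auto simp: set_nats distinct_nats)
qed

section \<open>The program deciding satisfiability\<close>

text \<open>The approximation algorithm is guaranteed to work only from a clean store, so the
  working variables of the reduction have to be reset before it starts.\<close>

primrec clear :: "nat \<Rightarrow> com" where
  "clear 0 = Skip"
| "clear (Suc n) = Seq (clear n) (Assign (Suc n) LeafE)"

lemma deterministic_clear [simp]: "deterministic (clear n)"
  by (induction n) auto

lemma executes_clear: "\<exists>t \<le> 2 * n + 1. executes (clear n) s t (\<lambda>y. if 1 \<le> y \<and> y \<le> n then Leaf else s y)"
proof (induction n)
  case 0
  have "(\<lambda>y. if 1 \<le> y \<and> y \<le> 0 then Leaf else s y) = s" by auto
  then show ?case using executes_Skip[of s] by (intro exI[of _ 1]) simp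
next
  case (Suc n)
  let ?s = "\<lambda>n y. if 1 \<le> y \<and> y \<le> n then Leaf else s y"
  from Suc obtain t where t: "t \<le> 2 * n + 1" "executes (clear n) s t (?s n)" by blast
  have "(?s n)(Suc n := Leaf) = ?s (Suc n)" by (auto simp: fun_eq_iff)
  with executes_Assign[of "Suc n" LeafE "?s n"] have "executes (Assign (Suc n) LeafE) (?s n) 1 (?s (Suc n))"
    by simp
  from executes_Seq[OF t(2) this] t(1) show ?case
    by (intro exI[of _ "Suc (t + 1)"]) simp
qed

text \<open>A returned solution either is \<open>{1}\<close> or avoids 1, so its first listed
  facility decides: the \<open>Tl\<close> of its encoding is \<open>Leaf\<close> exactly if the
  number is at most 1.\<close>

definition decider :: "val \<Rightarrow> com \<Rightarrow> nat \<Rightarrow> com \<Rightarrow> com" where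
  "decider \<kappa> r b c = Seq (Assign 0 (NodeE (exp_of \<kappa>) (Var 0))) (Seq r (Seq (clear b) (Seq c
     (If (Tl (Hd (Var 0))) (Assign 0 (NodeE LeafE LeafE)) (Assign 0 LeafE)))))"

lemma run_decider:
  assumes r: "realizes r b f T" and c: "computes_within c (f (Node \<kappa> x)) t y"
  shows "\<exists>t' s. t' \<le> T (Node \<kappa> x) + t + (2 * b + 10) \<and>
    run t' (start (decider \<kappa> r b c) x) = return_pmf ([], s) \<and>
    s 0 = enc_bool (right (left y) \<noteq> Leaf)"
proof -
  let ?s0 = "(\<lambda>_. Leaf)(0 := x) :: store" and ?s1 = "(\<lambda>_. Leaf)(0 := Node \<kappa> x) :: store"
  have e1: "executes (Assign 0 (NodeE (exp_of \<kappa>) (Var 0))) ?s0 1 ?s1"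
    using executes_Assign[of 0 "NodeE (exp_of \<kappa>) (Var 0)" ?s0] by simp
  from r obtain t2 s2 where 2: "t2 \<le> T (?s1 0)" "executes r ?s1 t2 s2" "s2 0 = f (?s1 0)"
    "\<And>y. y \<ge> b \<Longrightarrow> s2 y = ?s1 y" by (rule realizesE[where s = ?s1]) blast
  from executes_clear[of b s2] obtain t3 where 3: "t3 \<le> 2 * b + 1"
    "executes (clear b) s2 t3 (\<lambda>y. if 1 \<le> y \<and> y \<le> b then Leaf else s2 y)" by blast
  have "(\<lambda>y. if 1 \<le> y \<and> y \<le> b then Leaf else s2 y) = (\<lambda>_. Leaf)(0 := f (Node \<kappa> x))"
  proof
    fix z show "(if 1 \<le> z \<and> z \<le> b then Leaf else s2 z) = ((\<lambda>_. Leaf)(0 := f (Node \<kappa> x))) z"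
      using 2(3) 2(4)[of z] by (cases "z = 0") auto
  qed
  with 3 have e3: "executes (clear b) s2 t3 ((\<lambda>_. Leaf)(0 := f (Node \<kappa> x)))" by simp
  from computes_within_executes[OF c] obtain t4 s4 where
    4: "t4 \<le> t" "executes c ((\<lambda>_. Leaf)(0 := f (Node \<kappa> x))) t4 s4" "s4 0 = y" by blast
  let ?e = "if right (left y) \<noteq> Leaf then NodeE LeafE LeafE else LeafE"
  let ?s5 = "s4(0 := enc_bool (right (left y) \<noteq> Leaf))"
  have "executes (If (Tl (Hd (Var 0))) (Assign 0 (NodeE LeafE LeafE)) (Assign 0 LeafE)) s4 (Suc 1) ?s5"
    by (rule executes_If) (use executes_Assign[of 0 ?e s4] 4(3) in \<open>auto simp: enc_bool_def\<close>)
  from executes_Seq[OF e1 executes_Seq[OF 2(2) executes_Seq[OF e3 executes_Seq[OF 4(2) this]]]]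
  have "run (Suc (1 + Suc (t2 + Suc (t3 + Suc (t4 + Suc 1))))) (start (decider \<kappa> r b c) x) =
      return_pmf ([], ?s5)"
    unfolding start_def decider_def executes_def by blast
  then show ?thesis
    using 2(1) 3(1) 4(1) by (intro exI[of _ "Suc (1 + Suc (t2 + Suc (t3 + Suc (t4 + Suc 1))))"]
        exI[of _ ?s5]) simp
qed

primrec unary :: "nat \<Rightarrow> val" where
  "unary 0 = Leaf"
| "unary (Suc n) = Node Leaf (unary n)"

lemma unary_simps [simp]: "length (vlist (unary n)) = n" "size (unary n) = n"
  by (induction n) auto

section \<open>Running times\<close>

text \<open>For fixed \<open>k\<close> this absorbs polynomial factors in \<open>N\<close> into
  exponentials; it is 1 + x \<le> exp x at x = (N / k) ln 2.\<close>

lemma Suc_le_two_powr: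
  fixes k N :: nat
  assumes "0 < k"
  shows "real N + 1 \<le> 2 * real k * 2 powr (real N / real k)"
proof -
  let ?y = "real N / real k"
  have "1 + ?y / 2 \<le> 1 + ?y * ln 2"
    using ln2_ge_two_thirds mult_left_mono[of "1/2" "ln 2" ?y] by simp
  also have "\<dots> \<le> exp (?y * ln 2)" by (rule exp_ge_add_one_self)
  also have "\<dots> = 2 powr ?y" by (simp add: powr_def)
  finally have "2 * real k * (1 + ?y / 2) \<le> 2 * real k * 2 powr ?y"
    by (intro mult_left_mono) auto
  moreover have "2 * real k * (1 + ?y / 2) = 2 * real k + real N"
    using assms by (simp add: field_simps)
  moreover have "1 \<le> real k" using assms by simp
  ultimately show ?thesis by linarith
qed

text \<open>A block has at most 2 N / k + 1 positions, by the rounding to powers of two. The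
  additive 1 and the spare bit make up the factor 4.\<close>

lemma num_verts_le:
  "real (2 ^ num_bits K N) \<le> 4 * 2 ^ K * 2 powr (2 * real N / 2 ^ K)"
proof -
  let ?l = "length (vlist (enc_nat N))" and ?p = "length (vars K N)"
  have "real ?p \<le> 2 * real N / 2 ^ K + 1"
  proof (cases "?l \<le> K")
    case True
    then show ?thesis by (simp add: length_vars)
  next
    case False
    then have "0 < N" by (cases N) auto
    have "?p * 2 ^ K = 2 ^ ?l" using False by (simp add: length_vars flip: power_add)
    also have "\<dots> \<le> 2 * N" using two_power_length_enc_nat_le[OF \<open>0 < N\<close>] .
    finally have "real (?p * 2 ^ K) \<le> real (2 * N)" by (rule of_nat_mono)
    then have "real ?p \<le> 2 * real N / 2 ^ K" by (simp add: field_simps)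
    then show ?thesis by linarith
  qed
  then have "2 powr real ?p \<le> 2 powr (2 * real N / 2 ^ K + 1)" by simp
  then have "2 ^ ?p \<le> 2 powr (2 * real N / 2 ^ K) * 2" by (simp add: powr_realpow powr_add)
  then have "2 * 2 ^ K * 2 ^ ?p \<le> 2 * 2 ^ K * (2 powr (2 * real N / 2 ^ K) * 2)"
    by (intro mult_left_mono) auto
  then show ?thesis by (simp add: num_bits_def power_add mult_ac)
qed

text \<open>The encoded formula has size O(N ^ 2), so the square of \<open>Suc_le_two_powr\<close>
  covers it with the same power 2 ^ (2 N / k) that bounds the number of vertices. \<open>M\<close>
  may depend on \<open>K\<close>, which is fixed before the formula.\<close>

lemma reduce_measure_le:
  fixes \<Delta> :: real
  assumes "0 < \<Delta>"
  shows "\<exists>M > 0. \<forall>N \<phi>. is_3cnf N \<phi> \<and> real (length \<phi>) \<le> \<Delta> * real N \<longrightarrow>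
    real (Suc (reduce_measure (Node (unary K) (enc_cnf (N, \<phi>))))) \<le> M * 2 powr (2 * real N / 2 ^ K)"
proof -
  let ?k = "2 ^ K :: real"
  let ?M = "real K + 3 + ?k + (4 + 10 * \<Delta>) * (4 * ?k ^ 2) + 4 * ?k"
  have "real (Suc (reduce_measure (Node (unary K) (enc_cnf (N, \<phi>))))) \<le> ?M * 2 powr (2 * real N / ?k)"
    if \<phi>: "is_3cnf N \<phi>" "real (length \<phi>) \<le> \<Delta> * real N" for N \<phi>
  proof -
    let ?X = "2 powr (2 * real N / ?k)" and ?y = "real N + 1"
    have "?y \<le> 2 * ?k * 2 powr (real N / ?k)" using Suc_le_two_powr[of "2 ^ K" N] by simp
    then have "?y\<^sup>2 \<le> (2 * ?k * 2 powr (real N / ?k))\<^sup>2" by (intro power_mono) auto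
    also have "\<dots> = 4 * ?k\<^sup>2 * ?X"
      by (simp add: power_mult_distrib powr_add[symmetric] power2_eq_square[of "_ powr _"])
    finally have y: "?y\<^sup>2 \<le> 4 * ?k\<^sup>2 * ?X" .
    have "real (size (enc_cnf (N, \<phi>))) \<le> real (2 * N + 1 + length \<phi> * (6 * N + 10))"
      using size_enc_cnf[OF \<phi>(1)] by (rule of_nat_mono)
    also have "\<dots> = 2 * real N + 1 + real (length \<phi>) * (6 * real N + 10)" by simp
    also have "\<dots> \<le> 2 * ?y\<^sup>2 + (\<Delta> * ?y) * (10 * ?y)"
    proof (intro add_mono mult_mono)
      show "2 * real N + 1 \<le> 2 * ?y\<^sup>2" by (simp add: power2_eq_square algebra_simps)
      show "real (length \<phi>) \<le> \<Delta> * ?y" using \<phi>(2) assms by (simp add: algebra_simps)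
    qed (use assms in auto)
    finally have 1: "real (size (enc_cnf (N, \<phi>))) \<le> (2 + 10 * \<Delta>) * ?y\<^sup>2"
      by (simp add: power2_eq_square algebra_simps)
    have 2: "real (2 ^ length (vlist (enc_nat N))) \<le> 2 * ?y\<^sup>2"
    proof (cases "N = 0")
      case False
      then have "real (2 ^ length (vlist (enc_nat N))) \<le> real (2 * N)"
        by (intro of_nat_mono two_power_length_enc_nat_le) simp
      also have "\<dots> \<le> 2 * ?y\<^sup>2" by (simp add: power2_eq_square algebra_simps)
      finally show ?thesis .
    qed simp
    have "real (Suc (reduce_measure (Node (unary K) (enc_cnf (N, \<phi>))))) =
        real (size (enc_cnf (N, \<phi>))) + (real K + 2) + ?k + real (2 ^ length (vlist (enc_nat N))) +
        real (2 ^ num_bits K N)"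
      using length_vlist_num_bits_val[of "unary K" N] by (simp add: reduce_measure_def enc_cnf_eq)
    also have "\<dots> \<le> (2 + 10 * \<Delta>) * ?y\<^sup>2 + (real K + 2) + ?k + 2 * ?y\<^sup>2 + 4 * ?k * ?X"
      using 1 2 num_verts_le[of K N] by linarith
    also have "\<dots> = (4 + 10 * \<Delta>) * ?y\<^sup>2 + (real K + 2 + ?k) * 1 + 4 * ?k * ?X"
      by (simp add: algebra_simps)
    also have "\<dots> \<le> (4 + 10 * \<Delta>) * (4 * ?k\<^sup>2 * ?X) + (real K + 3 + ?k) * ?X + 4 * ?k * ?X"
      using assms y ge_one_powr_ge_zero[of 2 "2 * real N / ?k"]
      by (intro add_mono mult_left_mono mult_mono) auto
    also have "\<dots> = ?M * ?X" by (simp add: algebra_simps)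
    finally show ?thesis .
  qed
  moreover have "0 < ?M" using assms by (intro add_pos_nonneg add_nonneg_pos mult_nonneg_nonneg) auto
  ultimately show ?thesis by blast
qed

section \<open>Asymptotic comparisons and the hardness result\<close>

lemma poly_less_two_power: "\<exists>n0. \<forall>n \<ge> n0. poly p (real n) < 2 ^ (n - 1)"
proof -
  have "\<exists>C d. \<forall>x \<ge> 1. poly p x \<le> C * x ^ d \<and> 0 \<le> C" for p :: "real poly"
  proof (induction p)
    case 0
    show ?case by (intro exI[of _ 0]) simp
  next
    case (pCons a p)
    then obtain C d where C: "\<And>x. 1 \<le> x \<Longrightarrow> poly p x \<le> C * x ^ d \<and> 0 \<le> C" by blast
    have "poly (pCons a p) x \<le> (\<bar>a\<bar> + C) * x ^ Suc d \<and> 0 \<le> \<bar>a\<bar> + C" if x: "1 \<le> x" for x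
    proof -
      have "x * poly p x \<le> x * (C * x ^ d)" using C[OF x] x by (intro mult_left_mono) auto
      moreover have "\<bar>a\<bar> * 1 \<le> \<bar>a\<bar> * x ^ Suc d"
        using one_le_power[OF x, of "Suc d"] by (intro mult_left_mono) auto
      ultimately show ?thesis using C[OF x] by (simp add: algebra_simps)
    qed
    then show ?case by blast
  qed
  then obtain C d where C: "\<And>x. 1 \<le> x \<Longrightarrow> poly p x \<le> C * x ^ d" by blast
  have "((\<lambda>n. C * real n ^ d / 2 ^ n) \<longlonglongrightarrow> 0)" by real_asymp
  then have "eventually (\<lambda>n. C * real n ^ d / 2 ^ n < 1 / 2) sequentially"
    by (rule order_tendstoD) simp
  then obtain n0 where n0: "\<And>n. n0 \<le> n \<Longrightarrow> C * real n ^ d / 2 ^ n < 1 / 2"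
    by (auto simp: eventually_at_top_linorder)
  have "poly p (real n) < 2 ^ (n - 1)" if "max 1 n0 \<le> n" for n
  proof -
    have "(2 :: real) ^ n = 2 * 2 ^ (n - 1)" using that by (cases n) auto
    then show ?thesis using C[of "real n"] n0[of n] that by (simp add: field_simps)
  qed
  then show ?thesis by blast
qed

lemma prob_output_return:
  assumes "run t (start c x) = return_pmf ([], s)"
  shows "halts_within c x t" "prob_output c x t (s 0) = 1"
  using assms by (simp_all add: halts_within_def prob_output_def measure_return_pmf)

lemma cnf_sat_iff_num_sat: "cnf_sat \<phi> \<longleftrightarrow> (\<exists>a. num_sat a \<phi> = length \<phi>)"
  unfolding cnf_sat_def num_sat_def by (simp add: filter_id_conv flip: length_filter_less)
    (metis filter_id_conv length_filter_less less_irrefl)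

text \<open>Powers of two are unbounded, so the little-o bound is available at some budget
  \<open>2 ^ K\<close> with \<open>K\<close> beyond any prescribed \<open>K0\<close>.\<close>

lemma eventually_small:
  fixes g :: "nat \<Rightarrow> real"
  assumes "g \<in> o(\<lambda>k. real k)" "0 < \<delta>"
  shows "\<exists>K \<ge> K0. g (2 ^ K) \<le> \<delta> * 2 ^ K"
proof -
  from landau_o.smallD[OF assms] obtain k0 where k0: "\<And>k. k0 \<le> k \<Longrightarrow> \<bar>g k\<bar> \<le> \<delta> * real k"
    by (auto simp: eventually_at_top_linorder)
  have "k0 \<le> 2 ^ max K0 k0"
    using less_exp[of "max K0 k0"] by linarith
  from k0[OF this] show ?thesis by (intro exI[of _ "max K0 k0"]) auto
qed

theorem theorem3:
  assumes "gap_eth"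
  shows "\<forall>cost \<in> {med_cost, means_cost}.
    \<exists>\<I> :: fr_instance set. \<exists>b :: real.
      fr_o_family \<I> \<and>
      (\<forall>I \<in> \<I>. tree_metric I \<and>
         real (length (groups I)) \<le> b * real (budget I) ^ 3 * ln (real (num_verts I))) \<and>
      \<not> (\<exists>(c :: com) (f :: nat \<Rightarrow> nat) (g :: nat \<Rightarrow> real) (p :: real poly).
           computable f \<and> g \<in> o(\<lambda>k. real k) \<and>
           approximates_within c cost \<I>
             (\<lambda>I. real (f (budget I)) * real (num_verts I) powr g (budget I))
             (\<lambda>I. poly p (real (num_verts I))))"
proof
  fix cost assume cost: "cost \<in> {med_cost, means_cost}"
  from assms obtain \<epsilon> \<tau> \<Delta> where pos: "0 < \<epsilon>" "0 < \<tau>" "0 < \<Delta>"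
    and hard: "\<And>c. \<not> distinguishes_gap_3sat \<epsilon> \<tau> \<Delta> c"
    unfolding gap_eth_def by blast
  \<comment> \<open>One family serves all algorithms and all \<open>K\<close>; it depends only on
    the clause density \<Delta>.\<close>
  let ?\<I> = "star_family (2 * (1 + \<Delta>))"
  have False
    if g: "g \<in> o(\<lambda>k. real k)" and
      c: "approximates_within c cost ?\<I>
             (\<lambda>I. real (f (budget I)) * real (num_verts I) powr g (budget I))
             (\<lambda>I. poly p (real (num_verts I)))"
    for c and f :: "nat \<Rightarrow> nat" and g :: "nat \<Rightarrow> real" and p :: "real poly"
  proof -
    from polytime_reduce obtain r b T where r: "realizes r b reduce T" and "poly_bounded reduce_measure T"
      unfolding polytime_def by blast
    \<comment> \<open>\<open>d\<close> belongs to a program that gets \<open>K\<close> as input, so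
      it is fixed before \<open>K\<close> is chosen.\<close>
    then obtain C d where T: "\<And>x. T x \<le> C * Suc (reduce_measure x) ^ d" unfolding poly_bounded_def by blast
    from poly_less_two_power[of p] obtain n0 where n0: "\<And>n. n0 \<le> n \<Longrightarrow> poly p (real n) < 2 ^ (n - 1)"
      by blast
    \<comment> \<open>The number of vertices is of order 2 ^ (2 N / k); raised to the power \<delta>
      k it becomes 2 ^ (\<tau> N).\<close>
    define \<delta> where "\<delta> = \<tau> / 2"
    from pos have "0 < \<delta>" by (simp add: \<delta>_def)
    \<comment> \<open>\<open>n0 \<le> K\<close> makes the far weight exceed the approximation
      factor; the second bound gives 2 d / k \<le> \<tau>, so the d-th power of 2 ^ (2 N / k) stays
      below 2 ^ (\<tau> N).\<close>
    from eventually_small[OF g this, of "max n0 (nat \<lceil>2 * real d / \<tau>\<rceil>)"] obtain K where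
      K: "n0 \<le> K" "nat \<lceil>2 * real d / \<tau>\<rceil> \<le> K" and gK: "g (2 ^ K) \<le> \<delta> * 2 ^ K" by auto
    define k where "k = (2 ^ K :: real)"
    have k: "0 < k" "1 \<le> k" by (simp_all add: k_def)
    have "real K \<le> k" unfolding k_def using less_exp[of K] by (metis less_imp_le of_nat_le_iff of_nat_numeral of_nat_power)
    moreover have "2 * real d / \<tau> \<le> real K" using K(2) by linarith
    ultimately have d: "2 * real d / k \<le> \<tau>"
      using pos k by (simp add: field_simps) (meson mult_left_mono order_trans less_imp_le)
    from reduce_measure_le[OF pos(3), of K] obtain M where M: "0 < M"
      "\<And>N \<phi>. is_3cnf N \<phi> \<Longrightarrow> real (length \<phi>) \<le> \<Delta> * real N \<Longrightarrow>
        real (Suc (reduce_measure (Node (unary K) (enc_cnf (N, \<phi>))))) \<le> M * 2 powr (2 * real N / k)"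
      unfolding k_def by blast
    let ?P = "decider (unary K) r b c"
    \<comment> \<open>The summands pay for the reduction, for the approximation algorithm and for
      the fixed overhead; with \<open>K\<close> fixed all are constants.\<close>
    define B where "B = real C * M ^ d + real (f (2 ^ K)) * (4 * k) powr (\<delta> * k) + real (2 * b + 10)"
    have "distinguishes_gap_3sat \<epsilon> \<tau> \<Delta> ?P"
      unfolding distinguishes_gap_3sat_def
    proof (intro exI[of _ B] allI impI)
      fix N \<phi> assume "is_3cnf N \<phi> \<and> real (length \<phi>) \<le> \<Delta> * real N"
      then have \<phi>: "is_3cnf N \<phi>" "real (length \<phi>) \<le> \<Delta> * real N" by auto
      let ?I = "reduct K N \<phi>" and ?n = "2 ^ num_bits K N :: nat" and ?x = "enc_cnf (N, \<phi>)"
      have I: "budget ?I = 2 ^ K" "num_verts ?I = ?n" by (simp_all add: reduct_def)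
      have "?I \<in> ?\<I>" using \<phi>(2) pos(3) by (rule reduct_star_family)
      with c obtain t S where t: "real t \<le> real (f (2 ^ K)) * real ?n powr g (2 ^ K)"
        and out: "outputs_feasible c ?I t S"
        and apx: "cost ?I S \<le> ereal (poly p (real ?n)) * opt_cost cost ?I"
        unfolding approximates_within_def I[symmetric] by blast
      from out obtain xs where xs: "distinct xs" "set xs = S"
        and comp: "computes_within c (enc_instance ?I) t (enc_list enc_nat xs)"
        and feas: "fr_feasible ?I S" unfolding outputs_feasible_def by blast
      \<comment> \<open>\<open>K\<close> is below \<open>num_bits K N\<close> for every
        \<open>N\<close>, so short formulas need no separate treatment.\<close>
      have "n0 \<le> ?n"
        using K(1) less_exp[of "num_bits K N"] by (simp add: num_bits_def)
      from n0[OF this] have dec: "if cnf_sat \<phi> then 1 \<notin> S \<and> S \<noteq> {} else S = {1}"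
        using reduct_decides[OF cost \<phi>(1) feas apx] by simp
      have answer: "right (left (enc_list enc_nat xs)) \<noteq> Leaf \<longleftrightarrow> cnf_sat \<phi>"
      proof (cases xs)
        case Nil
        then show ?thesis using dec xs by (auto split: if_splits)
      next
        case (Cons y ys)
        then have "y \<in> S" using xs by auto
        moreover have "S \<subseteq> {1..<?n}" using feas by (simp add: reduct_feasible_iff)
        moreover from calculation have "1 \<le> y" by auto
        then have "y div 2 = 0 \<longleftrightarrow> y = 1" by auto
        ultimately show ?thesis using dec Cons by (auto split: if_splits)
      qed
      have reduce: "reduce (Node (unary K) ?x) = enc_instance ?I" using reduce_enc[of "unary K"] by simp
      from run_decider[OF r, of c "unary K" ?x t, unfolded reduce, OF comp] obtain t' s where
        t': "t' \<le> T (Node (unary K) ?x) + t + (2 * b + 10)"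
        and run: "run t' (start ?P ?x) = return_pmf ([], s)"
        and s: "s 0 = enc_bool (cnf_sat \<phi>)"
        unfolding answer by blast
      let ?E = "2 powr (\<tau> * real N)"
      have "real (T (Node (unary K) ?x)) \<le> real (C * Suc (reduce_measure (Node (unary K) ?x)) ^ d)"
        using T by (intro of_nat_mono)
      also have "\<dots> = real C * real (Suc (reduce_measure (Node (unary K) ?x))) ^ d" by simp
      also have "\<dots> \<le> real C * (M * 2 powr (2 * real N / k)) ^ d"
        using M(2)[OF \<phi>] by (intro mult_left_mono power_mono) auto
      also have "\<dots> = real C * M ^ d * 2 powr (2 * real N / k * real d)"
        by (simp add: power_mult_distrib powr_powr flip: powr_realpow)
      also have "2 powr (2 * real N / k * real d) \<le> ?E"
      proof -
        have "2 * real N / k * real d = (2 * real d / k) * real N" by simp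
        also have "\<dots> \<le> \<tau> * real N" using d by (intro mult_right_mono) auto
        finally show ?thesis by simp
      qed
      finally have 1: "real (T (Node (unary K) ?x)) \<le> real C * M ^ d * ?E"
        using M(1) by (simp add: mult_left_mono)
      have "real ?n powr g (2 ^ K) \<le> real ?n powr (\<delta> * k)"
        using gK by (intro powr_mono) (auto simp: k_def)
      also have "\<dots> \<le> (4 * k * 2 powr (2 * real N / k)) powr (\<delta> * k)"
        using num_verts_le[of K N] \<open>0 < \<delta>\<close> k by (intro powr_mono2) (auto simp: k_def)
      also have "\<dots> = (4 * k) powr (\<delta> * k) * 2 powr (2 * real N / k * (\<delta> * k))"
        using k by (simp add: powr_mult powr_powr)
      also have "2 * real N / k * (\<delta> * k) = \<tau> * real N" using k by (simp add: \<delta>_def)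
      finally have "real (f (2 ^ K)) * real ?n powr g (2 ^ K) \<le>
          real (f (2 ^ K)) * ((4 * k) powr (\<delta> * k) * ?E)"
        by (intro mult_left_mono) auto
      with t have 2: "real t \<le> real (f (2 ^ K)) * (4 * k) powr (\<delta> * k) * ?E" by simp
      have 3: "real (2 * b + 10) \<le> real (2 * b + 10) * ?E"
        using pos by (intro mult_le_cancel_left1[THEN iffD2]) (auto intro: ge_one_powr_ge_zero)
      have "real t' \<le> real (T (Node (unary K) ?x)) + real t + real (2 * b + 10)"
        using t' by (simp flip: of_nat_add)
      also have "\<dots> \<le> B * ?E" using 1 2 3 by (simp add: B_def algebra_simps)
      finally have time: "real t' \<le> B * ?E" .
      \<comment> \<open>The program decides satisfiability exactly; the gap enters only here, where
        it rules out a satisfying assignment.\<close>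
      have unsat: "\<not> cnf_sat \<phi>"
        if gap: "\<forall>a. real (num_sat a \<phi>) < (1 - \<epsilon>) * real (length \<phi>)"
      proof
        assume "cnf_sat \<phi>"
        then obtain a where "num_sat a \<phi> = length \<phi>" by (auto simp: cnf_sat_iff_num_sat)
        with gap have "real (length \<phi>) < (1 - \<epsilon>) * real (length \<phi>)" by metis
        with pos show False by (simp add: algebra_simps mult_less_0_iff)
      qed
      show "\<exists>t. real t \<le> B * ?E \<and> halts_within ?P ?x t \<and>
         ((\<exists>a. num_sat a \<phi> = length \<phi>) \<longrightarrow> prob_output ?P ?x t (enc_bool True) \<ge> 2/3) \<and>
         ((\<forall>a. real (num_sat a \<phi>) < (1 - \<epsilon>) * real (length \<phi>)) \<longrightarrow>
            prob_output ?P ?x t (enc_bool False) \<ge> 2/3)"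
        using time prob_output_return[OF run] s unsat
        by (intro exI[of _ t']) (auto simp flip: cnf_sat_iff_num_sat)
    qed
    with hard show False by blast
  qed
  then show "\<exists>\<I> :: fr_instance set. \<exists>b :: real.
      fr_o_family \<I> \<and>
      (\<forall>I \<in> \<I>. tree_metric I \<and>
         real (length (groups I)) \<le> b * real (budget I) ^ 3 * ln (real (num_verts I))) \<and>
      \<not> (\<exists>(c :: com) (f :: nat \<Rightarrow> nat) (g :: nat \<Rightarrow> real) (p :: real poly).
           computable f \<and> g \<in> o(\<lambda>k. real k) \<and>
           approximates_within c cost \<I>
             (\<lambda>I. real (f (budget I)) * real (num_verts I) powr g (budget I))
             (\<lambda>I. poly p (real (num_verts I))))"
    using fr_o_star_family star_family_tree_metric
    by (intro exI[of _ ?\<I>] exI[of _ "2 * (1 + \<Delta>)"]) blast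
qed

end
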